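(* Let $d\ge 2$ and let $\eta\colon\mathcal{P}_p^*(\mathbb{R}^d)\to\mathbb{R}$ be a simple $\mathrm{SO}(d)$-invariant valuation on the set of nonzero pointed polyhedral cones in $\mathbb{R}^d$, with simple extension $\bar\eta$ to all polyhedral cones. Suppose that for every pointed simplicial cone $F\subseteq\mathbb{R}^d$ of dimension $d-1$, the function $$x\longmapsto\eta(F+\mathbb{R}_{\ge0}x)$$ is integrable on $\mathbb{S}^{d-1}\setminus\operatorname{lin}F$ (with respect to $\sigma$). Then $$\eta(P)=\bar\eta(\mathbb{R}^d)\,v_d(P)\qquad\text{for all }P\in\mathcal{P}_p^*(\mathbb{R}^d),$$ where $v_d(P)=\sigma(P\cap\mathbb{S}^{d-1})$.
   Context: Cones are nonempty closed convex sets $C\subseteq\mathbb{R}^d$ with $\lambda C=C$ for all $\lambda>0$; $C$ is pointed if $C\cap(-C)=\{0\}$. $\mathcal{P}(\mathbb{R}^d)$ is the set of all polyhedral cones and $\mathcal{P}_p^*(\mathbb{R}^d)$ the set of nonzero pointed polyhedral cones. A pointed simplicial cone is the set of nonnegative linear combinations of finitely many linearly independent vectors. $\operatorname{lin}F$ is the linear span of $F$, and $\dim F=\dim\operatorname{lin}F$. $\sigma$ is the completion of the normalised (probability) rotation-invariant measure on $\mathbb{S}^{d-1}$. For $\mathcal{D}\in\{\mathcal{P}(\mathbb{R}^d),\mathcal{P}_p^*(\mathbb{R}^d)\}$, a functional $\eta\colon\mathcal{D}\to\mathbb{R}$ is a valuation if $\eta(C_1\cup C_2)=\eta(C_1)+\eta(C_2)-\eta(C_1\cap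 C_2)$ whenever $C_1,C_2,C_1\cup C_2\in\mathcal{D}$ (for $\mathcal{D}=\mathcal{P}_p^*(\mathbb{R}^d)$ the intersection is then automatically nonzero); it is simple if it vanishes on every cone in $\mathcal{D}$ of dimension at most $d-1$; it is $\mathrm{SO}(d)$-invariant if $\eta(gC)=\eta(C)$ for all $g\in\mathrm{SO}(d)$, $C\in\mathcal{D}$. Simple extension: every simple valuation $\eta$ on $\mathcal{P}_p^*(\mathbb{R}^d)$ has a unique extension to a simple valuation $\bar\eta$ on $\mathcal{P}(\mathbb{R}^d)$; it is given by $\bar\eta(P)=\sum_{O\in\mathcal{O}}\eta(P\cap O)$, where $\mathcal{O}$ is the family of the $2^d$ closed full-dimensional orthants of any orthonormal basis of $\mathbb{R}^d$ and $\eta(\{0\}):=0$. *)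

theory Defs
  imports "HOL-Probability.Probability"
begin

section \<open>Polyhedral cones\<close>

text \<open>A cone is a nonempty closed convex set invariant under positive dilations.
  For closed sets this is the library predicate \<^const>\<open>convex_cone\<close>.\<close>

lemma closed_convex_cone_iff:
  fixes C :: "'a::real_normed_vector set"
  shows "closed C \<and> convex_cone C \<longleftrightarrow>
    C \<noteq> {} \<and> closed C \<and> convex C \<and> (\<forall>c>0. (*\<^sub>R) c ` C = C)"
proof (intro iffI conjI; (elim conjE)?)
  assume "convex_cone C"
  then have sc: "c *\<^sub>R x \<in> C" if "x \<in> C" "0 \<le> c" for x c
    using that by (simp add: convex_cone_iff)
  show "\<forall>c>0. (*\<^sub>R) c ` C = C"
  proof (intro allI impI)
    fix c :: real assume "0 < c"
    show "(*\<^sub>R) c ` C = C"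
    proof
      show "(*\<^sub>R) c ` C \<subseteq> C" using sc \<open>0 < c\<close> by auto
      show "C \<subseteq> (*\<^sub>R) c ` C"
      proof
        fix x assume "x \<in> C"
        then have "x = c *\<^sub>R (inverse c *\<^sub>R x)" "inverse c *\<^sub>R x \<in> C"
          using sc \<open>0 < c\<close> by auto
        then show "x \<in> (*\<^sub>R) c ` C" by blast
      qed
    qed
  qed
next
  assume C: "C \<noteq> {}" "closed C" "convex C" "\<forall>c>0. (*\<^sub>R) c ` C = C"
  have pos: "c *\<^sub>R x \<in> C" if "x \<in> C" "0 < c" for x c
    using C(4) that by blast
  have "0 \<in> C"
  proof -
    obtain x where x: "x \<in> C" using C(1) by blast
    have "(\<lambda>n. (1 / real (Suc n)) *\<^sub>R x) \<longlonglongrightarrow> 0 *\<^sub>R x"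
      by (intro tendsto_scaleR tendsto_const LIMSEQ_Suc lim_1_over_n)
    moreover have "(1 / real (Suc n)) *\<^sub>R x \<in> C" for n
      by (rule pos[OF x]) simp
    ultimately show ?thesis
      using closed_sequentially[OF C(2)] by fastforce
  qed
  then have "conic C"
    unfolding conic_def using pos by (metis less_eq_real_def scaleR_zero_left)
  then show "convex_cone C" using C by (simp add: convex_cone_def)
qed (auto simp: convex_cone_def)

text \<open>\<open>polyhedron\<close> already contains closedness.\<close>

definition polyhedral_cones :: "(real^'d) set set" where
  "polyhedral_cones = {C. polyhedron C \<and> convex_cone C}"

definition pointed_cone :: "(real^'d) set \<Rightarrow> bool" where
  "pointed_cone C \<longleftrightarrow> C \<inter> uminus ` C = {0}"

definition nonzero_pointed_polyhedral_cones :: "(real^'d) set set" where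
  "nonzero_pointed_polyhedral_cones = {C \<in> polyhedral_cones. pointed_cone C \<and> C \<noteq> {0}}"

definition pointed_simplicial_cone :: "(real^'d) set \<Rightarrow> bool" where
  "pointed_simplicial_cone F \<longleftrightarrow>
    (\<exists>B. finite B \<and> independent B \<and>
       F = {\<Sum>b\<in>B. u b *\<^sub>R b | u. \<forall>b\<in>B. (0::real) \<le> u b})"

definition add_ray :: "(real^'d) set \<Rightarrow> real^'d \<Rightarrow> (real^'d) set" where
  "add_ray F x = {y + c *\<^sub>R x | y c. y \<in> F \<and> 0 \<le> c}"


section \<open>Valuations\<close>

text \<open>A functional on a family \<open>D\<close> of cones is a total function on sets of which only the
  values on members of \<open>D\<close> matter.  If \<open>C\<^sub>1\<close>, \<open>C\<^sub>2\<close> and their union are nonzero pointed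
  polyhedral cones, then so is their intersection, so no value outside \<open>D\<close> enters in
  either of the two cases used here.\<close>

definition valuation_on :: "(real^'d) set set \<Rightarrow> ((real^'d) set \<Rightarrow> real) \<Rightarrow> bool" where
  "valuation_on D \<eta> \<longleftrightarrow>
    (\<forall>C\<^sub>1\<in>D. \<forall>C\<^sub>2\<in>D. C\<^sub>1 \<union> C\<^sub>2 \<in> D \<longrightarrow> \<eta> (C\<^sub>1 \<union> C\<^sub>2) = \<eta> C\<^sub>1 + \<eta> C\<^sub>2 - \<eta> (C\<^sub>1 \<inter> C\<^sub>2))"

definition simple_on :: "(real^'d) set set \<Rightarrow> ((real^'d) set \<Rightarrow> real) \<Rightarrow> bool" where
  "simple_on D \<eta> \<longleftrightarrow> (\<forall>C\<in>D. dim C \<le> CARD('d) - 1 \<longrightarrow> \<eta> C = 0)"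

definition SO_invariant_on :: "(real^'d) set set \<Rightarrow> ((real^'d) set \<Rightarrow> real) \<Rightarrow> bool" where
  "SO_invariant_on D \<eta> \<longleftrightarrow>
    (\<forall>g::real^'d^'d. rotation_matrix g \<longrightarrow> (\<forall>C\<in>D. \<eta> ((*v) g ` C) = \<eta> C))"

definition is_simple_extension ::
    "((real^'d) set \<Rightarrow> real) \<Rightarrow> ((real^'d) set \<Rightarrow> real) \<Rightarrow> bool" where
  "is_simple_extension \<eta> \<eta>' \<longleftrightarrow>
    valuation_on polyhedral_cones \<eta>' \<and> simple_on polyhedral_cones \<eta>' \<and>
    (\<forall>C\<in>nonzero_pointed_polyhedral_cones. \<eta>' C = \<eta> C)"

text \<open>The extension is unique only on polyhedral cones, not as a function on arbitrary sets;
  hence the description is applied to its value at the cone \<open>P\<close>.\<close>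

definition simple_extension :: "((real^'d) set \<Rightarrow> real) \<Rightarrow> (real^'d) set \<Rightarrow> real" where
  "simple_extension \<eta> P = (THE y. \<exists>\<eta>'. is_simple_extension \<eta> \<eta>' \<and> \<eta>' P = y)"


section \<open>The rotation-invariant probability measure on the sphere\<close>

text \<open>It is realised as the image of the uniform distribution on the unit ball under radial
  projection; the value \<open>sgn 0 = 0\<close> off the sphere only affects a null set.\<close>

definition sphere_borel_prob :: "(real^'d) measure" where
  "sphere_borel_prob =
    restrict_space (distr (uniform_measure lborel (cball 0 1)) borel sgn) (sphere 0 1)"

definition sphere_prob :: "(real^'d) measure" where
  "sphere_prob = completion sphere_borel_prob"

definition cone_vol :: "(real^'d) set \<Rightarrow> real" where
  "cone_vol P = measure sphere_prob (P \<inter> sphere 0 1)"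

lemma lborel_distr_orthogonal:
  fixes f :: "'a::euclidean_space \<Rightarrow> 'a"
  assumes f: "orthogonal_transformation f"
  shows "distr lborel borel f = lborel"
proof -
  have lin: "linear f" using f by (simp add: orthogonal_transformation_linear)
  have fm: "f \<in> borel_measurable borel"
    using lin by (simp add: borel_measurable_continuous_onI linear_continuous_on
        linear_conv_bounded_linear)
  have inj: "inj f" using f by (simp add: orthogonal_transformation_inj)
  have surj: "surj f" using f by (simp add: orthogonal_transformation_surj)
  have "emeasure lborel (f -` box l u) = emeasure lborel (box l u)" for l u :: 'a
  proof -
    let ?U = "f -` box l u"
    have U: "open ?U"
      using lin by (intro open_vimage open_box linear_continuous_on)
        (simp add: linear_conv_bounded_linear)
    define K where "K = {p :: 'a \<times> real. 0 < snd p \<and> ball (fst p) (snd p) \<subseteq> ?U}"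
    have "\<exists>i. i \<in> K \<and> x \<in> ball (fst i) (snd i) \<and> snd i < d" if x: "x \<in> ?U" and d: "0 < d" for x d
    proof -
      obtain e where e: "0 < e" "ball x e \<subseteq> ?U"
        using U x by (meson openE)
      have "ball x (min e (d/2)) \<subseteq> ?U" using e by auto
      then show ?thesis
        using e d by (intro exI[of _ "(x, min e (d/2))"]) (auto simp: K_def)
    qed
    then obtain C where C: "countable C" "C \<subseteq> K"
        "pairwise (\<lambda>i j. disjnt (ball (fst i) (snd i)) (ball (fst j) (snd j))) C"
        "negligible (?U - (\<Union>i\<in>C. ball (fst i) (snd i)))"
      using Vitali_covering_theorem_balls[of ?U K fst snd] by blast
    let ?V = "\<Union>i\<in>C. ball (fst i) (snd i)"
    have sub: "?V \<subseteq> ?U" using C(2) by (auto simp: K_def)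
    have img: "f ` ?U = box l u" using surj by auto
    have fball: "f ` ball x r = ball (f x) r" for x r
      using f by (rule image_orthogonal_transformation_ball)
    have fV: "f ` ?V = (\<Union>i\<in>C. ball (f (fst i)) (snd i))"
      by (simp add: image_UN fball)
    have oV: "open ?V" by auto
    have ofV: "open (f ` ?V)" unfolding fV by auto
    have neg2: "negligible (box l u - f ` ?V)"
    proof -
      have "box l u - f ` ?V = f ` (?U - ?V)"
        by (simp only: image_set_diff[OF inj] img)
      also have "negligible \<dots>"
      proof (intro negligible_locally_Lipschitz_image[OF order_refl C(4)])
        fix x
        have "norm (f y - f x) \<le> 1 * norm (y - x)" for y
          by (simp add: linear_diff[OF lin, symmetric] orthogonal_transformation_norm[OF f])
        then show "\<exists>T B. open T \<and> x \<in> T \<and>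
            (\<forall>y\<in>(?U - ?V) \<inter> T. norm (f y - f x) \<le> B * norm (y - x))"
          by (intro exI[of _ UNIV] exI[of _ 1]) auto
      qed
      finally show ?thesis .
    qed
    have ext: "emeasure lborel B = emeasure lborel A"
      if "open A" "open B" "A \<subseteq> B" "negligible (B - A)" for A B :: "'a set"
    proof -
      have "emeasure lborel (B - A) = 0"
        using that by (simp add: negligible_iff_null_sets null_sets_def)
      moreover have "emeasure lborel A + emeasure lborel (B - A) = emeasure lborel (A \<union> (B - A))"
        using that by (intro plus_emeasure) auto
      moreover have "A \<union> (B - A) = B" using that by auto
      ultimately show ?thesis by simp
    qed
    have d1: "disjoint_family_on (\<lambda>i. ball (fst i) (snd i)) C"
      using C(3) by (auto simp: disjoint_family_on_def pairwise_def disjnt_def)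
    have d2: "disjoint_family_on (\<lambda>i. ball (f (fst i)) (snd i)) C"
      unfolding disjoint_family_on_def
    proof (intro ballI impI)
      fix i j assume "i \<in> C" "j \<in> C" "i \<noteq> j"
      then have "ball (fst i) (snd i) \<inter> ball (fst j) (snd j) = {}"
        using d1 by (auto simp: disjoint_family_on_def)
      then show "ball (f (fst i)) (snd i) \<inter> ball (f (fst j)) (snd j) = {}"
        unfolding fball[symmetric] using inj by (metis image_Int image_empty)
    qed
    have eb: "emeasure lborel (ball (f x) r) = emeasure lborel (ball x r)" for x r
      by (cases "0 \<le> r") (simp_all add: emeasure_ball ball_empty)
    have "emeasure lborel ?U = emeasure lborel ?V"
      by (rule ext[OF oV U sub C(4)])
    also have "\<dots> = (\<integral>\<^sup>+i. emeasure lborel (ball (fst i) (snd i)) \<partial>count_space C)"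
      by (rule emeasure_UN_countable[OF _ C(1) d1]) auto
    also have "\<dots> = (\<integral>\<^sup>+i. emeasure lborel (ball (f (fst i)) (snd i)) \<partial>count_space C)"
      by (simp add: eb)
    also have "\<dots> = emeasure lborel (f ` ?V)"
      unfolding fV by (rule emeasure_UN_countable[OF _ C(1) d2, symmetric]) auto
    also have "\<dots> = emeasure lborel (box l u)"
      using sub img by (intro ext[OF ofV open_box _ neg2, symmetric]) blast
    finally show ?thesis .
  qed
  then have "lborel = distr lborel borel f"
    using fm by (intro lborel_eqI) (simp_all add: emeasure_distr)
  then show ?thesis by simp
qed

lemma sphere_borel_closed: "sphere (0::real^'d) 1 \<in> sets borel"
  by (simp add: borel_closed)

lemma space_sphere_borel_prob: "space (sphere_borel_prob :: (real^'d) measure) = sphere 0 1"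
  by (simp add: sphere_borel_prob_def space_restrict_space)

lemma sets_sphere_borel_prob:
  "sets (sphere_borel_prob :: (real^'d) measure) = sets (restrict_space borel (sphere 0 1))"
  by (simp add: sphere_borel_prob_def sets_restrict_space)

lemma emeasure_sphere_borel_prob:
  fixes A :: "(real^'d) set"
  assumes "A \<in> sets borel" "A \<subseteq> sphere 0 1"
  shows "emeasure sphere_borel_prob A =
    emeasure lborel (cball 0 1 \<inter> sgn -` A) / emeasure lborel (cball (0::real^'d) 1)"
proof -
  have "sgn -` A \<in> sets (borel :: (real^'d) measure)"
    using measurable_sets[OF borel_measurable_sgn assms(1)] by simp
  with assms show ?thesis
    by (simp add: sphere_borel_prob_def emeasure_restrict_space emeasure_distr)
qed

lemma prob_space_sphere_borel_prob: "prob_space (sphere_borel_prob :: (real^'d) measure)"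
proof
  let ?B = "cball (0::real^'d) 1"
  have "?B \<inter> sgn -` sphere 0 1 = ?B - {0}"
    by (auto simp: norm_sgn)
  moreover have "emeasure lborel (?B - {0}) = emeasure lborel ?B"
    by (subst emeasure_Diff) auto
  moreover have "emeasure lborel ?B \<noteq> 0"
  proof -
    have "0 < measure lborel ?B" using content_cball_pos[of 1 "0::real^'d"] by simp
    then show ?thesis by (auto simp: measure_def)
  qed
  moreover have "emeasure lborel ?B \<noteq> \<infinity>"
    using emeasure_bounded_finite[of ?B] by auto
  ultimately show "emeasure sphere_borel_prob (space sphere_borel_prob :: (real^'d) set) = 1"
    by (simp add: space_sphere_borel_prob emeasure_sphere_borel_prob sphere_borel_closed
        ennreal_divide_self top.not_eq_extremum)
qed

lemma rotation_invariant_sphere_borel_prob: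
  fixes g :: "real^'d^'d"
  assumes g: "rotation_matrix g"
  shows "distr sphere_borel_prob sphere_borel_prob ((*v) g) = sphere_borel_prob"
proof -
  let ?g = "(*v) g"
  have ot: "orthogonal_transformation ?g"
    using g by (simp add: rotation_matrix_def orthogonal_transformation_matrix)
  have nrm: "norm (g *v x) = norm x" for x
    using ot orthogonal_transformation_norm by blast
  have cont: "continuous_on UNIV ?g"
    using ot by (simp add: orthogonal_transformation_linear linear_continuous_on
        linear_conv_bounded_linear)
  have gm: "?g \<in> borel_measurable borel"
    by (rule borel_measurable_continuous_onI[OF cont])
  have gs: "?g \<in> measurable sphere_borel_prob sphere_borel_prob"
    using gm nrm
    by (subst measurable_cong_sets[OF sets_sphere_borel_prob sets_sphere_borel_prob])
       (auto intro!: measurable_restrict_space3)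
  have sgng: "sgn (g *v x) = g *v sgn x" for x
    by (simp add: sgn_div_norm nrm matrix_vector_mult_scaleR)
  show ?thesis
  proof (rule measure_eqI)
    fix A assume "A \<in> sets (distr (sphere_borel_prob :: (real^'d) measure) sphere_borel_prob ?g)"
    then have A': "A \<in> sets sphere_borel_prob" by simp
    then have A: "A \<in> sets borel" "A \<subseteq> sphere 0 1"
      by (auto simp: sets_sphere_borel_prob sets_restrict_space_iff sphere_borel_closed)
    let ?T = "cball (0::real^'d) 1 \<inter> sgn -` A"
    let ?S = "cball (0::real^'d) 1 \<inter> sgn -` (?g -` A \<inter> sphere 0 1)"
    have gA: "?g -` A \<inter> sphere 0 1 \<in> sets borel"
      using measurable_sets[OF gm A(1)] sphere_borel_closed by auto
    have Tb: "?T \<in> sets borel"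
      using measurable_sets[OF borel_measurable_sgn A(1)] by auto
    have Sb: "?S \<in> sets borel"
      using measurable_sets[OF borel_measurable_sgn gA] by auto
    have sp: "sgn x \<in> sphere 0 1" if "g *v sgn x \<in> A" for x
      using that A(2) nrm by fastforce
    have "?S = ?g -` ?T"
      using sp by (auto simp: nrm sgng)
    then have "emeasure lborel ?S = emeasure (distr lborel borel ?g) ?T"
      using gm Tb by (simp add: emeasure_distr)
    then have "emeasure lborel ?T = emeasure lborel ?S"
      using lborel_distr_orthogonal[OF ot] by simp
    then show "emeasure (distr sphere_borel_prob sphere_borel_prob ?g) A
        = emeasure sphere_borel_prob A"
      using A gA
      by (simp add: emeasure_distr[OF gs A'] space_sphere_borel_prob emeasure_sphere_borel_prob)
  qed simp
qed

end

theory Submission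
  imports Defs
begin

text \<open>The proof dissects cones and averages over the dissections.  A simplicial cone of full
  dimension is the cone of a frame, that is, of a family \<open>v\<close> of vectors indexed by the coordinates
  with nonzero determinant.  The product of the sign of the determinant with the value of \<open>\<eta>\<close> at
  the cone of \<open>v\<close>, called \<open>oriented v\<close>, changes sign when two vectors of \<open>v\<close> are interchanged, and
  it behaves like a cocycle: replace each vector of \<open>v\<close> in turn by a further vector \<open>x\<close>.  If \<open>x\<close> has
  a positive coordinate with respect to \<open>v\<close>, then the values so obtained sum up to \<open>oriented v\<close>; this
  is lemma \<open>oriented_subdivision\<close>, a signed form of stellar subdivision at \<open>x\<close>.  If all coordinates
  of \<open>x\<close> are negative, then the cone of \<open>v\<close> and those obtained by the replacements tile the whole
  space, and the values of \<open>\<eta>\<close> on them sum up to a number \<open>\<kappa>\<close>.  Exchanging the vectors one at a time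
  shows that \<open>\<kappa>\<close> is the same for all choices of \<open>v\<close> and \<open>x\<close> (lemma \<open>fan_total_const\<close>).

  Now let \<open>x\<close> be uniformly distributed on the sphere.  The second case occurs exactly when \<open>x\<close> lies
  in the interior of the reflected cone, which has the probability \<open>cone_vol\<close> of the cone of \<open>v\<close>.
  Integrability permits taking expectations term by term, so
  \<open>oriented v\<close> is \<open>\<kappa>\<close> times the signed volume plus a sum of one mean per facet of the cone
  (lemma \<open>oriented_eq_facet_means\<close>).

  These facet means cancel (lemma \<open>sum_facet_means\<close>).  The ball inscribed in the cone touches facet
  \<open>i\<close> at an interior point \<open>f i\<close>, and stellar subdivision at \<open>f i\<close> splits the mean of facet \<open>i\<close> into
  means \<open>M i j\<close>, one for each other facet \<open>j\<close>.  The reflection that exchanges the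
  hyperplanes of the facets \<open>i\<close> and \<open>j\<close> fixes the face where they meet and exchanges \<open>f i\<close> and \<open>f j\<close>.
  It reverses orientation, but preceded by the reflection in the hyperplane of facet \<open>i\<close> it becomes a
  rotation.  Rotation invariance of \<open>\<eta>\<close> and of the measure then gives \<open>M i j = - M j i\<close>.
  The same pairing of pieces is the classical reason why a simplex is equidissectable to its mirror
  image.

  So \<open>\<eta>\<close> and \<open>\<kappa>\<close> times the volume agree on simplicial cones of full dimension, and a functional that
  is additive under cuts by hyperplanes and vanishes on such cones and on degenerate ones
  vanishes on every cone of the family (locale \<open>frame_null_functional\<close>).  The same
  principle, used for the difference of an extension and \<open>\<kappa>\<close> times the volume on all polyhedral
  cones, identifies \<open>\<kappa>\<close> as the value of the simple extension at the whole space.\<close>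

section \<open>Frames and their cones\<close>

text \<open>Frames are functions on the coordinate type itself rather than finite sets: determinants then
  need no enumeration, and replacing the vector at position \<open>i\<close> is a function update.\<close>

definition frame_det :: "('d \<Rightarrow> real^'d) \<Rightarrow> real" where
  "frame_det v = det (\<chi> i. v i)"

definition frame_cone :: "('d::finite \<Rightarrow> real^'d) \<Rightarrow> (real^'d) set" where
  "frame_cone v = {\<Sum>i\<in>UNIV. c i *\<^sub>R v i | c. \<forall>i. 0 \<le> c i}"

lemma frame_det_upd_add:
  "frame_det (v(k := x + y)) = frame_det (v(k := x)) + frame_det (v(k := y))"
  using det_row_add[of k "\<lambda>_. x" "\<lambda>_. y" v] by (simp add: frame_det_def fun_upd_def)

lemma frame_det_upd_scale:
  "frame_det (v(k := a *\<^sub>R x)) = a * frame_det (v(k := x))"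
  using det_row_mul[of k a "\<lambda>_. x" v]
  by (simp add: frame_det_def fun_upd_def scalar_mult_eq_scaleR cong: if_cong)

text \<open>Cramer's rule.\<close>

lemma frame_det_upd_sum:
  "frame_det (v(k := \<Sum>i\<in>UNIV. c i *\<^sub>R v i)) = c k * frame_det v"
  using cramer_lemma_transpose[of k "\<chi> i. c i" "\<chi> i. v i"]
  by (simp add: frame_det_def fun_upd_def scalar_mult_eq_scaleR row_def vec_lambda_eta cong: if_cong)

lemma frame_det_eq_0:
  assumes "i \<noteq> j" "v i = v j"
  shows "frame_det v = 0"
  unfolding frame_det_def
  by (rule det_identical_rows[OF assms(1)]) (simp add: row_def assms(2))

lemma frame_det_swap:
  assumes "i \<noteq> j"
  shows "frame_det (v(i := x, j := y)) = - frame_det (v(i := y, j := x))"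
proof -
  have "0 = frame_det (v(i := x + y, j := x + y))"
    using assms by (intro frame_det_eq_0[symmetric, of i j]) auto
  also have "\<dots> = frame_det (v(i := x + y, j := x)) + frame_det (v(i := x + y, j := y))"
    by (rule frame_det_upd_add)
  also have "\<dots> = frame_det (v(j := x, i := x + y)) + frame_det (v(j := y, i := x + y))"
    using assms by (simp add: fun_upd_twist)
  also have "\<dots> = frame_det (v(j := x, i := x)) + frame_det (v(j := x, i := y))
      + (frame_det (v(j := y, i := x)) + frame_det (v(j := y, i := y)))"
    by (simp add: frame_det_upd_add)
  also have "frame_det (v(j := x, i := x)) = 0"
    using assms by (intro frame_det_eq_0[of i j]) auto
  also have "frame_det (v(j := y, i := y)) = 0"
    using assms by (intro frame_det_eq_0[of i j]) auto
  finally have "frame_det (v(j := x, i := y)) + frame_det (v(j := y, i := x)) = 0"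
    by linarith
  moreover have "v(j := a, i := b) = v(i := b, j := a)" for a b
    using assms by (rule fun_upd_twist[OF not_sym])
  ultimately show ?thesis by (metis add.commute eq_neg_iff_add_eq_0)
qed

lemma frame_det_upd_two:
  assumes "i \<noteq> k"
  shows "frame_det (v(i := a *\<^sub>R v i + b *\<^sub>R v k)) = a * frame_det v"
proof -
  have "frame_det (v(i := v k)) = 0"
    using assms by (intro frame_det_eq_0[of i k]) auto
  then show ?thesis by (simp add: frame_det_upd_add frame_det_upd_scale)
qed

lemma linear_frame_det_upd: "linear (\<lambda>x. frame_det (v(i := x)))"
  by (rule linearI) (simp_all add: frame_det_upd_add frame_det_upd_scale)

lemma frame_combination_unique:
  assumes "frame_det v \<noteq> 0" "(\<Sum>i\<in>UNIV. c i *\<^sub>R v i) = (\<Sum>i\<in>UNIV. b i *\<^sub>R v i)"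
  shows "c k = b k"
  using frame_det_upd_sum[of v k c] frame_det_upd_sum[of v k b] assms by simp

text \<open>By Cramer's rule this is the coordinate of \<open>x\<close> at \<open>v k\<close> in the basis \<open>v\<close>; as a quotient of
  determinants it controls the sign of the determinant after a replacement.\<close>

definition frame_coord :: "('d \<Rightarrow> real^'d) \<Rightarrow> 'd \<Rightarrow> real^'d \<Rightarrow> real" where
  "frame_coord v k x = frame_det (v(k := x)) / frame_det v"

lemma frame_coord_sum:
  "frame_det v \<noteq> 0 \<Longrightarrow> frame_coord v k (\<Sum>i\<in>UNIV. c i *\<^sub>R v i) = c k"
  by (simp add: frame_coord_def frame_det_upd_sum)

lemma frame_det_eq_coord:
  "frame_det v \<noteq> 0 \<Longrightarrow> frame_det (v(k := x)) = frame_coord v k x * frame_det v"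
  by (simp add: frame_coord_def)

lemma frame_expansion:
  fixes v :: "'d::finite \<Rightarrow> real^'d"
  assumes "frame_det v \<noteq> 0"
  shows "x = (\<Sum>i\<in>UNIV. frame_coord v i x *\<^sub>R v i)"
proof -
  have "invertible (\<chi> i. v i)"
    using assms by (simp add: frame_det_def invertible_det_nz)
  then obtain B where "B ** (\<chi> i. v i) = mat 1" by (auto simp: invertible_def)
  then have "transpose (\<chi> i. v i) *v (transpose B *v x) = x"
    by (simp only: matrix_vector_mul_assoc matrix_transpose_mul[symmetric] transpose_mat matrix_vector_mul_lid)
  then have x: "x = (\<Sum>i\<in>UNIV. (transpose B *v x) $ i *\<^sub>R v i)"
    by (simp add: matrix_mult_sum column_transpose row_def scalar_mult_eq_scaleR vec_lambda_eta)
  show ?thesis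
    by (subst (1 2) x) (simp add: frame_coord_sum[OF assms])
qed

lemma linear_frame_coord: "linear (frame_coord v k)"
  by (rule linearI) (simp_all add: frame_coord_def frame_det_upd_add frame_det_upd_scale
      add_divide_distrib)

lemma frame_coord_self:
  "frame_det v \<noteq> 0 \<Longrightarrow> frame_coord v k (v i) = (if i = k then 1 else 0)"
  using frame_det_eq_0[of k i "v(k := v i)"] by (auto simp: frame_coord_def)

lemma frame_independent:
  fixes v :: "'d::finite \<Rightarrow> real^'d"
  assumes "frame_det v \<noteq> 0"
  shows "inj v" "independent (range v)"
proof -
  show inj: "inj v"
    using frame_det_eq_0[of _ _ v] assms by (auto simp: inj_def)
  have "u (v k) = 0" if "(\<Sum>b\<in>range v. u b *\<^sub>R b) = 0" for u k
    using that frame_combination_unique[OF assms, of "\<lambda>i. u (v i)" "\<lambda>_. 0"] inj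
    by (simp add: sum.reindex)
  then show "independent (range v)"
    by (auto simp: dependent_finite)
qed

lemma frame_cone_iff:
  assumes "frame_det v \<noteq> 0"
  shows "x \<in> frame_cone v \<longleftrightarrow> (\<forall>i. 0 \<le> frame_coord v i x)"
proof
  assume "x \<in> frame_cone v"
  then show "\<forall>i. 0 \<le> frame_coord v i x"
    by (auto simp: frame_cone_def frame_coord_sum[OF assms])
next
  assume "\<forall>i. 0 \<le> frame_coord v i x"
  then show "x \<in> frame_cone v"
    unfolding frame_cone_def
    by (intro CollectI exI[of _ "\<lambda>i. frame_coord v i x"] conjI frame_expansion[OF assms])
qed

lemma frame_cone_swap:
  assumes "i \<noteq> j"
  shows "frame_cone (v(i := x, j := y)) = frame_cone (v(i := y, j := x))"
proof -
  have "frame_cone (v(i := x, j := y)) \<subseteq> frame_cone (v(i := y, j := x))" for x y :: "real^'a"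
  proof
    fix z assume "z \<in> frame_cone (v(i := x, j := y))"
    then obtain c where c: "z = (\<Sum>k\<in>UNIV. c k *\<^sub>R (v(i := x, j := y)) k)" "\<forall>k. 0 \<le> c k"
      by (auto simp: frame_cone_def)
    let ?t = "Transposition.transpose i j"
    have "z = (\<Sum>k\<in>UNIV. c (?t k) *\<^sub>R (v(i := x, j := y)) (?t k))"
      unfolding c(1) by (rule sum.reindex_bij_witness[of _ ?t ?t]) auto
    also have "\<dots> = (\<Sum>k\<in>UNIV. c (?t k) *\<^sub>R (v(i := y, j := x)) k)"
      using assms by (intro sum.cong) (auto simp: Transposition.transpose_def)
    finally show "z \<in> frame_cone (v(i := y, j := x))"
      using c(2) unfolding frame_cone_def by (intro CollectI exI[of _ "\<lambda>k. c (?t k)"]) auto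
  qed
  then show ?thesis by blast
qed

lemma frame_cone_scale:
  assumes "0 < a"
  shows "frame_cone (v(k := a *\<^sub>R v k)) = frame_cone v"
proof
  show "frame_cone (v(k := a *\<^sub>R v k)) \<subseteq> frame_cone v"
  proof
    fix z assume "z \<in> frame_cone (v(k := a *\<^sub>R v k))"
    then obtain c where c: "z = (\<Sum>i\<in>UNIV. c i *\<^sub>R (v(k := a *\<^sub>R v k)) i)" "\<forall>i. 0 \<le> c i"
      by (auto simp: frame_cone_def)
    have "z = (\<Sum>i\<in>UNIV. (c(k := c k * a)) i *\<^sub>R v i)"
      unfolding c(1) by (intro sum.cong) auto
    then show "z \<in> frame_cone v"
      using c(2) assms unfolding frame_cone_def by (intro CollectI exI[of _ "c(k := c k * a)"]) auto
  qed
  show "frame_cone v \<subseteq> frame_cone (v(k := a *\<^sub>R v k))"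
  proof
    fix z assume "z \<in> frame_cone v"
    then obtain c where c: "z = (\<Sum>i\<in>UNIV. c i *\<^sub>R v i)" "\<forall>i. 0 \<le> c i"
      by (auto simp: frame_cone_def)
    have "z = (\<Sum>i\<in>UNIV. (c(k := c k / a)) i *\<^sub>R (v(k := a *\<^sub>R v k)) i)"
      unfolding c(1) using assms by (intro sum.cong) auto
    then show "z \<in> frame_cone (v(k := a *\<^sub>R v k))"
      using c(2) assms unfolding frame_cone_def by (intro CollectI exI[of _ "c(k := c k / a)"]) auto
  qed
qed

section \<open>Polyhedral cones as intersections of half-spaces\<close>

text \<open>The half-spaces that define the polyhedron have bounding hyperplanes off the origin in general.
  Shifting them to the origin does not change the set, since a linear functional that is bounded
  above on a cone is nonpositive there.\<close>

lemma polyhedral_cone_iff: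
  "C \<in> polyhedral_cones \<longleftrightarrow> (\<exists>N. finite N \<and> C = {y. \<forall>h\<in>N. 0 \<le> h \<bullet> y})"
proof
  assume C: "C \<in> polyhedral_cones"
  then have cc: "convex_cone C" and "polyhedron C" by (auto simp: polyhedral_cones_def)
  then obtain F where F: "finite F" "C = \<Inter>F"
      "\<And>h. h \<in> F \<Longrightarrow> \<exists>a b. a \<noteq> 0 \<and> h = {x. a \<bullet> x \<le> b}"
    by (auto simp: polyhedron_def)
  then obtain a b where ab: "\<And>h. h \<in> F \<Longrightarrow> h = {x. a h \<bullet> x \<le> b h}" by metis
  have mem: "x \<in> h \<longleftrightarrow> a h \<bullet> x \<le> b h" if "h \<in> F" for x h
    using ab[OF that] by (metis mem_Collect_eq)
  have sc: "c *\<^sub>R x \<in> C" if "x \<in> C" "0 \<le> c" for x c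
    using that cc by (simp add: convex_cone_iff)
  have neg: "a h \<bullet> x \<le> 0" if h: "h \<in> F" and x: "x \<in> C" for h x
  proof (rule ccontr)
    assume "\<not> a h \<bullet> x \<le> 0"
    then have pos: "0 < a h \<bullet> x" by simp
    define c where "c = (\<bar>b h\<bar> + 1) / (a h \<bullet> x)"
    have "c *\<^sub>R x \<in> h" using sc[OF x, of c] pos F(2) h by (auto simp: c_def)
    then have "c * (a h \<bullet> x) \<le> b h" using mem[OF h] by simp
    then show False using pos by (simp add: c_def)
  qed
  have "0 \<in> C" using cc by (simp add: convex_cone_contains_0)
  then have b0: "0 \<le> b h" if "h \<in> F" for h
    using F(2) mem[OF that, of 0] that \<open>0 \<in> C\<close> by auto
  have "C = {y. \<forall>h\<in>(\<lambda>h. - a h) ` F. 0 \<le> h \<bullet> y}"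
  proof
    show "C \<subseteq> {y. \<forall>h\<in>(\<lambda>h. - a h) ` F. 0 \<le> h \<bullet> y}" using neg by auto
    show "{y. \<forall>h\<in>(\<lambda>h. - a h) ` F. 0 \<le> h \<bullet> y} \<subseteq> C"
    proof
      fix y assume y: "y \<in> {y. \<forall>h\<in>(\<lambda>h. - a h) ` F. 0 \<le> h \<bullet> y}"
      have "y \<in> h" if h: "h \<in> F" for h
        using y h b0[OF h] mem[OF h, of y] by auto
      then show "y \<in> C" using F(2) by blast
    qed
  qed
  then show "\<exists>N. finite N \<and> C = {y. \<forall>h\<in>N. 0 \<le> h \<bullet> y}" using F(1) by blast
next
  assume "\<exists>N. finite N \<and> C = {y. \<forall>h\<in>N. 0 \<le> h \<bullet> y}"
  then obtain N where N: "finite N" "C = {y. \<forall>h\<in>N. 0 \<le> h \<bullet> y}" by blast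
  have "C = \<Inter>((\<lambda>h. {y. 0 \<le> h \<bullet> y}) ` N)" using N(2) by auto
  moreover have "polyhedron (\<Inter>((\<lambda>h. {y. 0 \<le> h \<bullet> y}) ` N))"
    using N(1) polyhedron_halfspace_ge[where b = 0] by (intro polyhedron_Inter) auto
  ultimately have "polyhedron C" by simp
  moreover have "convex_cone C"
    unfolding N(2) by (auto simp: convex_cone_iff inner_right_distrib)
  ultimately show "C \<in> polyhedral_cones" by (simp add: polyhedral_cones_def)
qed

lemma polyhedral_cone_halfspace: "{y. 0 \<le> h \<bullet> y} \<in> polyhedral_cones"
  unfolding polyhedral_cone_iff by (intro exI[of _ "{h}"]) auto

lemma polyhedral_cone_Int:
  assumes "C \<in> polyhedral_cones" "D \<in> polyhedral_cones"
  shows "C \<inter> D \<in> polyhedral_cones"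
proof -
  obtain N M where "finite N" "finite M" "C = {y. \<forall>h\<in>N. 0 \<le> h \<bullet> y}" "D = {y. \<forall>h\<in>M. 0 \<le> h \<bullet> y}"
    using assms by (auto simp: polyhedral_cone_iff)
  then show ?thesis
    unfolding polyhedral_cone_iff by (intro exI[of _ "N \<union> M"]) auto
qed

lemma polyhedral_cone_0: "C \<in> polyhedral_cones \<Longrightarrow> 0 \<in> C"
  by (auto simp: polyhedral_cone_iff)

lemma polyhedral_cone_scale: "C \<in> polyhedral_cones \<Longrightarrow> x \<in> C \<Longrightarrow> 0 \<le> a \<Longrightarrow> a *\<^sub>R x \<in> C"
  by (auto simp: polyhedral_cone_iff)

lemma polyhedral_cone_convex: "C \<in> polyhedral_cones \<Longrightarrow> convex C"
  by (simp add: polyhedral_cones_def convex_cone_def)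

lemma polyhedral_cone_closed: "C \<in> polyhedral_cones \<Longrightarrow> closed C"
  by (simp add: polyhedral_cones_def polyhedron_imp_closed)

lemma pointed_cone_subset:
  assumes "pointed_cone C" "D \<subseteq> C" "0 \<in> D"
  shows "pointed_cone D"
  using assms unfolding pointed_cone_def by force

section \<open>Simplicial cones of full dimension\<close>

text \<open>The dual basis, whose vectors are the inward normals of the facets of the cone.\<close>

definition frame_dual :: "('d \<Rightarrow> real^'d) \<Rightarrow> 'd::finite \<Rightarrow> real^'d" where
  "frame_dual v k = adjoint (frame_coord v k) 1"

lemma frame_coord_eq_inner: "frame_coord v k x = frame_dual v k \<bullet> x"
  using adjoint_works[OF linear_frame_coord, of x v k 1] by (simp add: frame_dual_def inner_commute)

lemma frame_cone_polyhedral: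
  assumes "frame_det v \<noteq> 0"
  shows "frame_cone v \<in> polyhedral_cones"
  unfolding polyhedral_cone_iff
  by (intro exI[of _ "range (frame_dual v)"])
     (auto simp: frame_cone_iff[OF assms] frame_coord_eq_inner)

lemma frame_cone_pointed:
  assumes "frame_det v \<noteq> 0"
  shows "pointed_cone (frame_cone v)"
proof -
  have "x = 0" if "x \<in> frame_cone v" "- x \<in> frame_cone v" for x
  proof -
    have "frame_coord v i x = 0" for i
      using that frame_cone_iff[OF assms]
      by (metis frame_coord_eq_inner inner_minus_right neg_0_le_iff_le order_antisym)
    then show ?thesis by (subst frame_expansion[OF assms, of x]) simp
  qed
  then show ?thesis
    using polyhedral_cone_0[OF frame_cone_polyhedral[OF assms]]
    unfolding pointed_cone_def by force
qed

lemma frame_vector_in_cone: "v i \<in> frame_cone v"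
  unfolding frame_cone_def
  by (intro CollectI exI[of _ "\<lambda>j. if j = i then 1 else 0"]) (simp add: if_distrib[of "\<lambda>c. c *\<^sub>R _"] cong: if_cong)

lemma frame_vector_nonzero: "frame_det v \<noteq> 0 \<Longrightarrow> v i \<noteq> 0"
  using frame_coord_self[of v i i] by (auto simp: frame_coord_eq_inner)

lemma frame_cone_mem:
  assumes "frame_det v \<noteq> 0"
  shows "frame_cone v \<in> nonzero_pointed_polyhedral_cones"
  using frame_cone_polyhedral[OF assms] frame_cone_pointed[OF assms]
    frame_vector_in_cone[of v undefined] frame_vector_nonzero[OF assms, of undefined]
  by (auto simp: nonzero_pointed_polyhedral_cones_def)

lemma frame_sum_upd:
  "(\<Sum>j\<in>UNIV. b j *\<^sub>R (v(i := x)) j) = b i *\<^sub>R x + (\<Sum>j\<in>UNIV-{i}. b j *\<^sub>R v j)"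
  for v :: "'d::finite \<Rightarrow> real^'d"
  by (subst sum.remove[of _ i]) (auto intro!: sum.cong)

text \<open>The pivot step of Gaussian elimination: the coordinates after one vector of a basis has been
  exchanged.\<close>

lemma frame_coord_upd:
  assumes "frame_det v \<noteq> 0" "frame_coord v i x \<noteq> 0"
  shows "frame_coord (v(i := x)) j y =
    (if j = i then frame_coord v i y / frame_coord v i x
     else frame_coord v j y - frame_coord v i y / frame_coord v i x * frame_coord v j x)"
proof -
  define e where "e j = (if j = i then frame_coord v i y / frame_coord v i x
     else frame_coord v j y - frame_coord v i y / frame_coord v i x * frame_coord v j x)" for j
  have D: "frame_det (v(i := x)) \<noteq> 0"
    using assms by (simp add: frame_det_eq_coord)
  have "(\<Sum>j\<in>UNIV. e j *\<^sub>R (v(i := x)) j) = e i *\<^sub>R x + (\<Sum>j\<in>UNIV-{i}. e j *\<^sub>R v j)"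
    by (rule frame_sum_upd)
  also have "e i *\<^sub>R x = e i *\<^sub>R (\<Sum>j\<in>UNIV. frame_coord v j x *\<^sub>R v j)"
    using frame_expansion[OF assms(1), of x] by simp
  also have "\<dots> = frame_coord v i y *\<^sub>R v i + (\<Sum>j\<in>UNIV-{i}. (e i * frame_coord v j x) *\<^sub>R v j)"
    using assms(2) by (subst sum.remove[of _ i]) (auto simp: e_def scaleR_right_distrib scaleR_sum_right)
  also have "\<dots> + (\<Sum>j\<in>UNIV-{i}. e j *\<^sub>R v j)
      = frame_coord v i y *\<^sub>R v i + (\<Sum>j\<in>UNIV-{i}. frame_coord v j y *\<^sub>R v j)"
    unfolding add.assoc sum.distrib[symmetric]
    by (intro arg_cong2[of _ _ _ _ "(+)"] sum.cong refl) (auto simp: e_def algebra_simps)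
  also have "\<dots> = (\<Sum>j\<in>UNIV. frame_coord v j y *\<^sub>R v j)"
    by (rule sum.remove[symmetric]) auto
  also have "\<dots> = y"
    by (rule frame_expansion[OF assms(1), symmetric])
  finally have "frame_coord (v(i := x)) j y = e j"
    using frame_coord_sum[OF D, of j e] by simp
  then show ?thesis by (simp add: e_def)
qed

text \<open>The cone is cut by the hyperplane through \<open>x\<close> and the vectors of \<open>v\<close> other than \<open>v i\<close> and
  \<open>v j\<close>; the two sides are told apart by comparing the ratio of the coordinates \<open>i\<close> and \<open>j\<close> with
  \<open>a\<close> to \<open>b\<close>.\<close>

lemma frame_cone_split:
  assumes v: "frame_det v \<noteq> 0" and ij: "i \<noteq> j" and ab: "0 < a" "0 < b"
    and x: "x = a *\<^sub>R v i + b *\<^sub>R v j"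
  shows "frame_cone v = frame_cone (v(i := x)) \<union> frame_cone (v(j := x))"
    and "\<exists>h. h \<noteq> 0 \<and> frame_cone (v(i := x)) \<inter> frame_cone (v(j := x)) \<subseteq> {y. h \<bullet> y = 0}"
proof -
  have x': "frame_coord v k x = (if k = i then a else if k = j then b else 0)" for k
    using ij by (auto simp: x linear_add[OF linear_frame_coord] linear_scale[OF linear_frame_coord]
        frame_coord_self[OF v])
  have D: "frame_det (v(i := x)) \<noteq> 0" "frame_det (v(j := x)) \<noteq> 0"
    using v ab ij x' by (simp_all add: frame_det_eq_coord)
  have ci: "y \<in> frame_cone (v(i := x)) \<longleftrightarrow>
      (\<forall>k. 0 \<le> frame_coord v k y) \<and> b * frame_coord v i y \<le> a * frame_coord v j y" for y
  proof -
    have "y \<in> frame_cone (v(i := x)) \<longleftrightarrow>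
      0 \<le> frame_coord v i y \<and> 0 \<le> frame_coord v j y - frame_coord v i y / a * b \<and>
      (\<forall>k. k \<noteq> i \<longrightarrow> k \<noteq> j \<longrightarrow> 0 \<le> frame_coord v k y)"
      using v ab ij by (auto simp: frame_cone_iff[OF D(1)] frame_coord_upd x' zero_le_divide_iff)
    also have "0 \<le> frame_coord v j y - frame_coord v i y / a * b \<longleftrightarrow>
      b * frame_coord v i y \<le> a * frame_coord v j y"
      using ab by (simp add: field_simps)
    finally show ?thesis
      using ab by (smt (verit) mult_nonneg_nonneg zero_le_mult_iff)
  qed
  have cj: "y \<in> frame_cone (v(j := x)) \<longleftrightarrow>
      (\<forall>k. 0 \<le> frame_coord v k y) \<and> a * frame_coord v j y \<le> b * frame_coord v i y" for y
  proof -
    have "y \<in> frame_cone (v(j := x)) \<longleftrightarrow>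
      0 \<le> frame_coord v j y \<and> 0 \<le> frame_coord v i y - frame_coord v j y / b * a \<and>
      (\<forall>k. k \<noteq> i \<longrightarrow> k \<noteq> j \<longrightarrow> 0 \<le> frame_coord v k y)"
      using v ab ij by (auto simp: frame_cone_iff[OF D(2)] frame_coord_upd x' zero_le_divide_iff)
    also have "0 \<le> frame_coord v i y - frame_coord v j y / b * a \<longleftrightarrow>
      a * frame_coord v j y \<le> b * frame_coord v i y"
      using ab by (simp add: field_simps)
    finally show ?thesis
      using ab by (smt (verit) mult_nonneg_nonneg zero_le_mult_iff)
  qed
  show "frame_cone v = frame_cone (v(i := x)) \<union> frame_cone (v(j := x))"
    by (auto simp: ci cj frame_cone_iff[OF v])
  let ?h = "a *\<^sub>R frame_dual v j - b *\<^sub>R frame_dual v i"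
  have "?h \<bullet> v j = a"
    using ij by (simp add: inner_diff_left frame_coord_self[OF v] flip: frame_coord_eq_inner)
  then have "?h \<noteq> 0" using ab by auto
  moreover have "?h \<bullet> y = 0" if "y \<in> frame_cone (v(i := x)) \<inter> frame_cone (v(j := x))" for y
    using that by (auto simp: ci cj inner_diff_left simp flip: frame_coord_eq_inner)
  ultimately show "\<exists>h. h \<noteq> 0 \<and> frame_cone (v(i := x)) \<inter> frame_cone (v(j := x)) \<subseteq> {y. h \<bullet> y = 0}"
    by blast
qed

text \<open>A segment from one cone to the other stays in the union and, being connected, meets the
  intersection.  It avoids the origin, because otherwise its ends would span a line in the pointed
  union.\<close>

lemma pointed_union_Int_nonzero:
  assumes C: "C1 \<in> polyhedral_cones" "C2 \<in> polyhedral_cones"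
    and U: "C1 \<union> C2 \<in> polyhedral_cones" "pointed_cone (C1 \<union> C2)"
    and nz: "C1 \<noteq> {0}" "C2 \<noteq> {0}"
  shows "C1 \<inter> C2 \<noteq> {0}"
proof -
  obtain p q where p: "p \<in> C1" "p \<noteq> 0" and q: "q \<in> C2" "q \<noteq> 0"
    using nz C polyhedral_cone_0 by blast
  have seg: "closed_segment p q \<subseteq> C1 \<union> C2"
    using polyhedral_cone_convex[OF U(1)] p q by (intro closed_segment_subset) auto
  have "\<exists>z \<in> closed_segment p q. z \<in> C1 \<inter> C2"
    using connected_closedD[OF connected_segment(1)[of p q] _ seg
        polyhedral_cone_closed[OF C(1)] polyhedral_cone_closed[OF C(2)]] p q
    by (metis Int_iff disjoint_iff ends_in_segment)
  then obtain z t where z: "z \<in> C1 \<inter> C2" and t: "0 \<le> t" "t \<le> 1" "z = (1 - t) *\<^sub>R p + t *\<^sub>R q"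
    by (auto simp: closed_segment_def)
  have "z \<noteq> 0"
  proof
    assume "z = 0"
    then have eq: "t *\<^sub>R q = - ((1 - t) *\<^sub>R p)" using t(3) by (simp add: add_eq_0_iff)
    have "t *\<^sub>R q \<in> C1 \<union> C2" "(1 - t) *\<^sub>R p \<in> C1 \<union> C2"
      using polyhedral_cone_scale[OF C(1) p(1)] polyhedral_cone_scale[OF C(2) q(1)] t by auto
    then have "t *\<^sub>R q \<in> (C1 \<union> C2) \<inter> uminus ` (C1 \<union> C2)"
      by (metis IntI eq imageI)
    then have "t *\<^sub>R q = 0" using U(2) unfolding pointed_cone_def by (metis singletonD)
    then have "t = 0" using q(2) by simp
    then show False using eq p(2) by simp
  qed
  then show ?thesis using z by blast
qed

section \<open>The cocycle of a simple valuation\<close>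

lemma sum_antisymmetric_offdiagonal:
  fixes f :: "'a::finite \<Rightarrow> 'a \<Rightarrow> real"
  assumes "\<And>i j. i \<noteq> j \<Longrightarrow> f i j = - f j i"
  shows "(\<Sum>i\<in>UNIV. \<Sum>j\<in>UNIV-{i}. f i j) = 0"
proof -
  have "(\<Sum>i\<in>UNIV. \<Sum>j\<in>UNIV-{i}. f i j) = (\<Sum>(i,j)\<in>Sigma UNIV (\<lambda>i. UNIV-{i}). f i j)"
    by (rule sum.Sigma) auto
  also have "\<dots> = (\<Sum>(i,j)\<in>Sigma UNIV (\<lambda>i. UNIV-{i}). f j i)"
    by (rule sum.reindex_bij_witness[of _ prod.swap prod.swap]) auto
  also have "\<dots> = (\<Sum>(i,j)\<in>Sigma UNIV (\<lambda>i. UNIV-{i}). - f i j)"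
    using assms by (intro sum.cong) force+
  also have "\<dots> = - (\<Sum>(i,j)\<in>Sigma UNIV (\<lambda>i. UNIV-{i}). f i j)"
    by (simp add: sum_negf case_prod_beta)
  also have "(\<Sum>(i,j)\<in>Sigma UNIV (\<lambda>i. UNIV-{i}). f i j) = (\<Sum>i\<in>UNIV. \<Sum>j\<in>UNIV-{i}. f i j)"
    by (rule sum.Sigma[symmetric]) auto
  finally show ?thesis by simp
qed

locale simple_cone_valuation =
  fixes \<eta> :: "(real^'d) set \<Rightarrow> real"
  assumes valuation: "valuation_on nonzero_pointed_polyhedral_cones \<eta>"
    and simple: "simple_on nonzero_pointed_polyhedral_cones \<eta>"
begin

lemma eta_in_hyperplane:
  assumes "C \<in> nonzero_pointed_polyhedral_cones" "h \<noteq> 0" "C \<subseteq> {y. h \<bullet> y = 0}"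
  shows "\<eta> C = 0"
proof -
  have "dim C \<le> dim {y. h \<bullet> y = 0}" by (rule dim_subset[OF assms(3)])
  then have "dim C \<le> CARD('d) - 1" using dim_hyperplane[OF assms(2)] by simp
  then show ?thesis using simple assms(1) by (simp add: simple_on_def)
qed

lemma eta_cut:
  assumes "C1 \<in> nonzero_pointed_polyhedral_cones" "C2 \<in> nonzero_pointed_polyhedral_cones"
    and U: "C1 \<union> C2 \<in> nonzero_pointed_polyhedral_cones"
    and h: "h \<noteq> 0" "C1 \<inter> C2 \<subseteq> {y. h \<bullet> y = 0}"
  shows "\<eta> (C1 \<union> C2) = \<eta> C1 + \<eta> C2"
proof -
  have "C1 \<inter> C2 \<in> polyhedral_cones" "C1 \<inter> C2 \<noteq> {0}"
    using assms pointed_union_Int_nonzero[of C1 C2]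
    by (auto simp: nonzero_pointed_polyhedral_cones_def intro: polyhedral_cone_Int)
  moreover from this have "pointed_cone (C1 \<inter> C2)"
    using U polyhedral_cone_0 pointed_cone_subset[of "C1 \<union> C2" "C1 \<inter> C2"]
    by (auto simp: nonzero_pointed_polyhedral_cones_def)
  ultimately have "\<eta> (C1 \<inter> C2) = 0"
    using h by (intro eta_in_hyperplane[of _ h]) (simp_all add: nonzero_pointed_polyhedral_cones_def)
  then show ?thesis using valuation assms(1-3) by (simp add: valuation_on_def)
qed

text \<open>The sign of the determinant makes the functional alternating, so that one formula covers
  all positions of a new vector relative to a cone.\<close>

definition oriented :: "('d \<Rightarrow> real^'d) \<Rightarrow> real" where
  "oriented v = sgn (frame_det v) * \<eta> (frame_cone v)"

lemma oriented_eq_0: "frame_det v = 0 \<Longrightarrow> oriented v = 0"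
  by (simp add: oriented_def)

lemma oriented_swap:
  "i \<noteq> j \<Longrightarrow> oriented (v(i := x, j := y)) = - oriented (v(i := y, j := x))"
  unfolding oriented_def by (simp add: frame_det_swap[of i j v x y] frame_cone_swap[of i j v x y] sgn_minus)

lemma oriented_scale:
  "0 < a \<Longrightarrow> oriented (v(k := a *\<^sub>R v k)) = oriented v"
  by (simp add: oriented_def frame_cone_scale frame_det_upd_scale sgn_mult)

text \<open>Degenerate frames are included: the determinants of the two new frames are multiples of the
  old one, so all terms vanish together.\<close>

lemma oriented_split_positive:
  assumes "i \<noteq> k" "0 < a" "0 < b"
  shows "oriented v = oriented (v(i := a *\<^sub>R v i + b *\<^sub>R v k)) + oriented (v(k := a *\<^sub>R v i + b *\<^sub>R v k))"
    (is "_ = oriented (?vi) + oriented ?vk")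
proof -
  have di: "frame_det ?vi = a * frame_det v"
    by (rule frame_det_upd_two[OF assms(1)])
  have dk: "frame_det ?vk = b * frame_det v"
    using frame_det_upd_two[OF not_sym[OF assms(1)], of v b a] by (simp add: add.commute)
  show ?thesis
  proof (cases "frame_det v = 0")
    case True
    then show ?thesis by (simp add: oriented_eq_0 di dk)
  next
    case False
    note split = frame_cone_split[OF False assms refl]
    obtain h where h: "h \<noteq> 0" "frame_cone ?vi \<inter> frame_cone ?vk \<subseteq> {y. h \<bullet> y = 0}"
      using split(2) by blast
    have "\<eta> (frame_cone ?vi \<union> frame_cone ?vk) = \<eta> (frame_cone ?vi) + \<eta> (frame_cone ?vk)"
      using False assms di dk
      by (intro eta_cut[OF _ _ _ h]) (auto intro: frame_cone_mem simp flip: split(1))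
    then show ?thesis
      using assms by (simp add: oriented_def di dk sgn_mult algebra_simps flip: split(1))
  qed
qed

text \<open>For negative \<open>a\<close> it is \<open>v k\<close> that lies between \<open>v i\<close> and the new vector, so the cone of
  \<open>v(k := a *\<^sub>R v i + v k)\<close> is the one that is cut; antisymmetry turns its pieces into the right form.\<close>

lemma oriented_split:
  assumes ik: "i \<noteq> k"
  shows "oriented v = oriented (v(i := a *\<^sub>R v i + v k)) + oriented (v(k := a *\<^sub>R v i + v k))"
proof -
  let ?x = "a *\<^sub>R v i + v k"
  consider "a = 0" | "0 < a" | "a < 0" by linarith
  then show ?thesis
  proof cases
    case 1
    then have "oriented (v(i := ?x)) = 0"
      using ik by (intro oriented_eq_0 frame_det_eq_0[of i k]) auto
    then show ?thesis using 1 by simp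
  next
    case 2
    then show ?thesis using oriented_split_positive[OF ik 2, of 1 v] by simp
  next
    case 3
    define u where "u = v(k := ?x)"
    have "(- a) *\<^sub>R u i + 1 *\<^sub>R u k = v k" using ik by (simp add: u_def)
    then have "oriented u = oriented (u(i := v k)) + oriented (u(k := v k))"
      using oriented_split_positive[OF ik, of "- a" 1 u] 3 by simp
    moreover have "u(k := v k) = v" by (simp add: u_def)
    moreover have "oriented (u(i := v k)) = - oriented (v(i := ?x))"
    proof -
      have "u(i := v k) = v(i := v k, k := ?x)" using ik by (simp add: u_def fun_upd_twist)
      moreover have "v(i := ?x, k := v k) = v(i := ?x)" using ik by auto
      ultimately show ?thesis using oriented_swap[OF ik, of v "v k" ?x] by simp
    qed
    ultimately show ?thesis by (simp add: u_def)
  qed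
qed

text \<open>Induction on the number of vectors that occur in the combination.  Let \<open>y\<close> be the
  combination without \<open>v k\<close> and \<open>x = c k *\<^sub>R v k + y\<close>.  The induction hypothesis replaces vectors by
  \<open>y\<close>, both in \<open>v\<close> and in \<open>v(k := x)\<close>, and \<open>oriented_split\<close> relates the two sums, because
  \<open>x\<close> combines just \<open>v k\<close> and \<open>y\<close>.  The index \<open>p\<close> of a positive coefficient is kept to the end,
  where it makes the base case a mere rescaling.\<close>

lemma oriented_subdivision_support:
  assumes "finite A" "p \<notin> A" "0 < c p"
  shows "oriented v = (\<Sum>i\<in>insert p A. oriented (v(i := \<Sum>j\<in>insert p A. c j *\<^sub>R v j)))"
  using assms(1,2)
proof (induction A arbitrary: v rule: finite_induct)
  case empty
  then show ?case using oriented_scale[OF assms(3), of v p] by (simp del: fun_upd_apply)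
next
  case (insert k A)
  let ?y = "\<lambda>v::'d \<Rightarrow> real^'d. \<Sum>j\<in>insert p A. c j *\<^sub>R v j"
  define y where "y = ?y v"
  define x where "x = c k *\<^sub>R v k + y"
  have kp: "k \<noteq> p" "k \<notin> insert p A" "finite (insert p A)" using insert by auto
  have x_eq: "(\<Sum>j\<in>insert p (insert k A). c j *\<^sub>R v j) = x"
    using kp insert.hyps by (simp add: x_def y_def insert_commute[of p k])
  have yk: "?y (v(k := x)) = y"
    unfolding y_def using kp by (intro sum.cong) auto
  have ih1: "oriented v = (\<Sum>i\<in>insert p A. oriented (v(i := y)))"
    using insert.IH[of v] insert.prems unfolding y_def by blast
  have ih2: "oriented (v(k := x)) = (\<Sum>i\<in>insert p A. oriented (v(k := x, i := y)))"
    using insert.IH[of "v(k := x)"] insert.prems unfolding yk by blast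
  have split: "oriented (v(i := y)) = oriented (v(k := x, i := y)) + oriented (v(i := x))"
    if "i \<in> insert p A" for i
  proof -
    have ki: "k \<noteq> i" using that kp by auto
    then have "oriented (v(i := y)) = oriented (v(i := y, k := x)) + oriented (v(i := y, i := x))"
      using oriented_split[OF ki, of "v(i := y)" "c k"] by (simp add: x_def)
    also have "v(i := y, k := x) = v(k := x, i := y)"
      using ki by (simp add: fun_upd_twist)
    finally show ?thesis by (simp del: fun_upd_apply)
  qed
  have "oriented v = (\<Sum>i\<in>insert p A. oriented (v(k := x, i := y)) + oriented (v(i := x)))"
    unfolding ih1 using split by (intro sum.cong) auto
  also have "\<dots> = oriented (v(k := x)) + (\<Sum>i\<in>insert p A. oriented (v(i := x)))"
    unfolding sum.distrib ih2 ..
  also have "\<dots> = (\<Sum>i\<in>insert p (insert k A). oriented (v(i := x)))"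
    using kp insert.hyps by (simp add: insert_commute[of p k])
  finally show ?case unfolding x_eq .
qed

lemma oriented_subdivision:
  assumes "0 < c p" "x = (\<Sum>j\<in>UNIV. c j *\<^sub>R v j)"
  shows "oriented v = (\<Sum>i\<in>UNIV. oriented (v(i := x)))"
proof -
  have "insert p (UNIV - {p}) = UNIV" by auto
  then show ?thesis
    using oriented_subdivision_support[of "UNIV - {p}" p c v] assms by simp
qed

section \<open>The total value of a complete fan\<close>

text \<open>If all coordinates of \<open>x\<close> are negative, then all the replaced frames have the opposite
  orientation, so up to the sign of \<open>frame_det v\<close> this is the sum of the values of \<open>\<eta>\<close> over the
  cones of a complete simplicial fan.\<close>

definition fan_defect :: "('d \<Rightarrow> real^'d) \<Rightarrow> real^'d \<Rightarrow> real" where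
  "fan_defect v x = oriented v - (\<Sum>i\<in>UNIV. oriented (v(i := x)))"

lemma fan_defect_eq_0:
  assumes "frame_det v \<noteq> 0" "0 < frame_coord v p x"
  shows "fan_defect v x = 0"
  using oriented_subdivision[of "\<lambda>i. frame_coord v i x" p x v] assms frame_expansion[OF assms(1), of x]
  by (simp add: fan_defect_def)

text \<open>Expand every \<open>oriented (v(i := x))\<close> along \<open>y\<close>.  The terms in which both \<open>x\<close> and \<open>y\<close> replace a
  vector of \<open>v\<close> cancel in pairs by antisymmetry.\<close>

lemma fan_defect_cong:
  assumes v: "frame_det v \<noteq> 0"
    and x: "\<And>i. frame_coord v i x < 0" and y: "\<And>i. frame_coord v i y < 0"
  shows "fan_defect v x = fan_defect v y"
proof -
  have "oriented (v(i := x)) = oriented (v(i := y)) + (\<Sum>j\<in>UNIV-{i}. oriented (v(i := x, j := y)))" for i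
  proof -
    have D: "frame_det (v(i := x)) \<noteq> 0"
      using v x[of i] by (simp add: frame_det_eq_coord)
    have "0 < frame_coord (v(i := x)) i y"
      using x[of i] y[of i] by (subst frame_coord_upd[OF v]) (simp_all add: divide_neg_neg)
    then have "fan_defect (v(i := x)) y = 0"
      by (rule fan_defect_eq_0[OF D])
    then have "oriented (v(i := x)) = (\<Sum>j\<in>UNIV. oriented (v(i := x, j := y)))"
      by (simp add: fan_defect_def)
    also have "\<dots> = oriented (v(i := x, i := y)) + (\<Sum>j\<in>UNIV-{i}. oriented (v(i := x, j := y)))"
      by (rule sum.remove) auto
    finally show ?thesis by simp
  qed
  then have "(\<Sum>i\<in>UNIV. oriented (v(i := x))) = (\<Sum>i\<in>UNIV. oriented (v(i := y)))
      + (\<Sum>i\<in>UNIV. \<Sum>j\<in>UNIV-{i}. oriented (v(i := x, j := y)))"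
    by (simp add: sum.distrib)
  also have "(\<Sum>i\<in>UNIV. \<Sum>j\<in>UNIV-{i}. oriented (v(i := x, j := y))) = 0"
  proof (rule sum_antisymmetric_offdiagonal)
    fix i j :: 'd assume "i \<noteq> j"
    then show "oriented (v(i := x, j := y)) = - oriented (v(j := x, i := y))"
      using oriented_swap[of i j v x y] by (simp add: fun_upd_twist)
  qed
  finally show ?thesis by (simp add: fan_defect_def del: fun_upd_apply)
qed

text \<open>The vector \<open>- (\<Sum>i\<in>UNIV. v i)\<close> is just a convenient one with all coordinates negative; by the
  previous lemma every such vector gives the same total.\<close>

definition fan_total :: "('d \<Rightarrow> real^'d) \<Rightarrow> real" where
  "fan_total v = sgn (frame_det v) * fan_defect v (- (\<Sum>i\<in>UNIV. v i))"

lemma fan_defect_negative: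
  assumes v: "frame_det v \<noteq> 0" and x: "\<And>i. frame_coord v i x < 0"
  shows "fan_defect v x = sgn (frame_det v) * fan_total v"
proof -
  have "frame_coord v i (- (\<Sum>i\<in>UNIV. v i)) < 0" for i
    using frame_coord_sum[OF v, of i "\<lambda>_. 1"] by (simp add: linear_neg[OF linear_frame_coord])
  from fan_defect_cong[OF v x this] show ?thesis
    using v by (simp add: fan_total_def sgn_real_def)
qed

text \<open>The frame \<open>v(i := x)\<close> together with \<open>v i\<close> spans the same complete fan as \<open>v\<close> together with
  \<open>x\<close>.\<close>

lemma fan_total_upd_negative:
  assumes v: "frame_det v \<noteq> 0" and x: "\<And>i. frame_coord v i x < 0"
  shows "fan_total (v(i := x)) = fan_total v"
proof -
  have D: "frame_det (v(i := x)) \<noteq> 0" and sgnD: "sgn (frame_det (v(i := x))) = - sgn (frame_det v)"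
    using v x[of i] by (simp_all add: frame_det_eq_coord sgn_mult)
  have neg: "frame_coord (v(i := x)) j (v i) < 0" for j
    using x[of i] x[of j]
    by (subst frame_coord_upd[OF v]) (auto simp: frame_coord_self[OF v] divide_neg_neg mult_neg_neg divide_less_0_iff zero_less_divide_iff)
  have "fan_defect (v(i := x)) (v i)
      = oriented (v(i := x)) - (oriented v + (\<Sum>j\<in>UNIV-{i}. oriented (v(i := x, j := v i))))"
    unfolding fan_defect_def by (subst sum.remove[of _ i]) auto
  also have "(\<Sum>j\<in>UNIV-{i}. oriented (v(i := x, j := v i))) = (\<Sum>j\<in>UNIV-{i}. - oriented (v(j := x)))"
  proof (rule sum.cong[OF refl])
    fix j assume "j \<in> UNIV - {i}"
    moreover have "v(i := v i, j := x) = v(j := x)" by simp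
    ultimately show "oriented (v(i := x, j := v i)) = - oriented (v(j := x))"
      using oriented_swap[of i j v x "v i"] by simp
  qed
  also have "oriented (v(i := x)) - (oriented v + (\<Sum>j\<in>UNIV-{i}. - oriented (v(j := x))))
      = - fan_defect v x"
    unfolding fan_defect_def by (subst (2) sum.remove[of _ i]) (auto simp: sum_negf)
  finally have "fan_defect (v(i := x)) (v i) = - fan_defect v x" .
  then have "sgn (frame_det (v(i := x))) * fan_total (v(i := x)) = - (sgn (frame_det v) * fan_total v)"
    unfolding fan_defect_negative[OF D neg] fan_defect_negative[OF v x] .
  then show ?thesis using v unfolding sgnD by (simp add: sgn_eq_0_iff)
qed

text \<open>Two exchanges of the kind in \<open>fan_total_upd_negative\<close> replace \<open>v i\<close> by an arbitrary vector \<open>y\<close>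
  on its own side of the facet opposite to it; one more reaches the other side.\<close>

lemma fan_total_upd:
  assumes v: "frame_det v \<noteq> 0" and vy: "frame_det (v(i := y)) \<noteq> 0"
  shows "fan_total (v(i := y)) = fan_total v"
proof -
  have pos: "fan_total (v(i := y)) = fan_total v" if v: "frame_det v \<noteq> 0" and p: "0 < frame_coord v i y" for v
  proof -
    \<comment> \<open>The vector \<open>x\<close> has negative coordinates in \<open>v\<close>, and those with index other than \<open>i\<close> are so
      large in absolute value that \<open>y\<close> has negative coordinates in \<open>v(i := x)\<close>.\<close>
    define c where "c j = (if j = i then - 1 else - (\<bar>frame_coord v j y\<bar> / frame_coord v i y + 1))" for j
    define x where "x = (\<Sum>j\<in>UNIV. c j *\<^sub>R v j)"
    have cx: "frame_coord v j x = c j" for j unfolding x_def by (rule frame_coord_sum[OF v])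
    have neg: "frame_coord v j x < 0" for j
    proof -
      have "0 \<le> \<bar>frame_coord v j y\<bar> / frame_coord v i y" using p by simp
      then show ?thesis unfolding cx c_def by (auto simp del: abs_ge_zero)
    qed
    have D: "frame_det (v(i := x)) \<noteq> 0"
      using v neg[of i] by (simp add: frame_det_eq_coord)
    have "frame_coord (v(i := x)) j y < 0" for j
    proof (cases "j = i")
      case True
      then show ?thesis using p neg[of i] by (subst frame_coord_upd[OF v]) (auto simp: divide_pos_neg)
    next
      case False
      have "frame_coord (v(i := x)) j y = frame_coord v j y - \<bar>frame_coord v j y\<bar> - frame_coord v i y"
        using False neg[of i] p by (subst frame_coord_upd[OF v]) (auto simp: cx c_def field_simps)
      then show ?thesis using p by linarith
    qed
    from fan_total_upd_negative[OF D this, of i] fan_total_upd_negative[OF v neg, of i]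
    show ?thesis by simp
  qed
  show ?thesis
  proof (cases "0 < frame_coord v i y")
    case True
    then show ?thesis by (rule pos[OF v])
  next
    case False
    define x where "x = - (\<Sum>j\<in>UNIV. v j)"
    have cx: "frame_coord v j x = - 1" for j
      using frame_coord_sum[OF v, of j "\<lambda>_. 1"] by (simp add: x_def linear_neg[OF linear_frame_coord])
    have D: "frame_det (v(i := x)) \<noteq> 0"
      using v cx[of i] by (simp add: frame_det_eq_coord)
    have "frame_coord v i y < 0" using False v vy by (auto simp: frame_det_eq_coord)
    then have "0 < frame_coord (v(i := x)) i y"
      by (subst frame_coord_upd[OF v]) (simp_all add: cx)
    from pos[OF D this] fan_total_upd_negative[OF v, of x i] show ?thesis by (simp add: cx)
  qed
qed

text \<open>Any two frames are connected by exchanges.  The standard basis vectors are brought in one at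
  a time; where a direct exchange at position \<open>k\<close> would give a degenerate frame, another vector is
  first sheared by \<open>w k\<close>.\<close>

lemma fan_total_const:
  assumes v: "frame_det v \<noteq> 0"
  shows "fan_total v = fan_total (\<lambda>i. axis i 1)"
proof -
  let ?e = "\<lambda>i::'d. axis i (1::real)"
  have "\<exists>w. frame_det w \<noteq> 0 \<and> fan_total w = fan_total v \<and> (\<forall>j\<in>J. w j = ?e j)"
    if "finite J" for J :: "'d set"
    using that
  proof (induction J)
    case empty
    then show ?case using v by blast
  next
    case (insert k J)
    then obtain w where w: "frame_det w \<noteq> 0" "fan_total w = fan_total v" "\<forall>j\<in>J. w j = ?e j"
      by blast
    show ?case
    proof (cases "frame_det (w(k := ?e k)) = 0")
      case False
      moreover have "\<forall>j\<in>insert k J. (w(k := ?e k)) j = ?e j" using w(3) by auto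
      moreover have "fan_total (w(k := ?e k)) = fan_total v"
        using fan_total_upd[OF w(1) False] w(2) by (rule trans)
      ultimately show ?thesis by blast
    next
      case True
      then have ck: "frame_coord w k (?e k) = 0" by (simp add: frame_coord_def)
      have "\<exists>i. i \<notin> J \<and> frame_coord w i (?e k) \<noteq> 0"
      proof (rule ccontr)
        assume "\<nexists>i. i \<notin> J \<and> frame_coord w i (?e k) \<noteq> 0"
        then have z: "frame_coord w i (?e k) = 0" if "i \<notin> J" for i using that by blast
        have "?e k = (\<Sum>i\<in>UNIV. frame_coord w i (?e k) *\<^sub>R w i)" by (rule frame_expansion[OF w(1)])
        also have "\<dots> = (\<Sum>i\<in>J. frame_coord w i (?e k) *\<^sub>R ?e i)"
          using z w(3) by (intro sum.mono_neutral_cong_right) auto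
        finally have "?e k $ k = (\<Sum>i\<in>J. frame_coord w i (?e k) *\<^sub>R ?e i) $ k" by simp
        also have "\<dots> = 0" using insert.hyps by (auto simp: axis_def intro!: sum.neutral)
        finally show False by simp
      qed
      then obtain i where i: "i \<notin> J" "frame_coord w i (?e k) \<noteq> 0" by blast
      then have ik: "i \<noteq> k" using ck by auto
      define u where "u = w(i := 1 *\<^sub>R w i + 1 *\<^sub>R w k)"
      have "frame_det u = frame_det w"
        unfolding u_def using frame_det_upd_two[OF ik, of w 1 1] by simp
      with w(1) have u: "frame_det u \<noteq> 0" by simp
      have "frame_det (u(k := ?e k)) = frame_det (w(k := ?e k, i := w i)) + frame_det (w(k := ?e k, i := w k))"
        unfolding u_def using ik by (simp add: fun_upd_twist frame_det_upd_add)
      also have "w(k := ?e k, i := w i) = w(k := ?e k)" using ik by auto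
      also have "frame_det (w(k := ?e k, i := w k)) = - frame_det (w(i := ?e k))"
        using frame_det_swap[OF not_sym[OF ik], of w "?e k" "w k"] by simp
      finally have uk: "frame_det (u(k := ?e k)) \<noteq> 0"
        using True i(2) w(1) by (simp add: frame_coord_def del: fun_upd_apply)
      moreover have "fan_total (u(k := ?e k)) = fan_total v"
        using fan_total_upd[OF u uk] fan_total_upd[OF w(1) u[unfolded u_def]] w(2)
        unfolding u_def by simp
      moreover have "\<forall>j\<in>insert k J. (u(k := ?e k)) j = ?e j" using w(3) i(1) by (auto simp: u_def)
      ultimately show ?thesis by blast
    qed
  qed
  from this[of UNIV] obtain w where "fan_total w = fan_total v" "\<forall>j. w j = ?e j" by auto
  moreover from this have "w = ?e" by auto
  ultimately show ?thesis by simp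
qed

end

section \<open>The measure on the sphere\<close>

lemma prob_space_sphere_prob: "prob_space (sphere_prob :: (real^'d) measure)"
  unfolding sphere_prob_def by (rule prob_space.prob_space_completion[OF prob_space_sphere_borel_prob])

lemma space_sphere_prob: "space (sphere_prob :: (real^'d) measure) = sphere 0 1"
  by (simp add: sphere_prob_def space_sphere_borel_prob)

lemma borel_measurable_sphere_prob:
  fixes f :: "real^'d \<Rightarrow> 'b::topological_space"
  assumes "f \<in> borel_measurable borel"
  shows "f \<in> borel_measurable sphere_prob"
proof -
  have "f \<in> borel_measurable (restrict_space borel (sphere 0 1))"
    using assms by (rule measurable_restrict_space1)
  then have "f \<in> borel_measurable (sphere_borel_prob :: (real^'d) measure)"
    using measurable_cong_sets[OF sets_sphere_borel_prob refl] by blast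
  then show ?thesis
    unfolding sphere_prob_def by (rule measurable_completion)
qed

lemma sets_sphere_borel_prob_Int:
  "A \<in> sets borel \<Longrightarrow> A \<inter> sphere 0 1 \<in> sets (sphere_borel_prob :: (real^'d) measure)"
  by (simp add: sets_sphere_borel_prob sets_restrict_space_iff sphere_borel_closed)

lemma cone_vol_eq:
  "A \<in> sets borel \<Longrightarrow> cone_vol A = measure sphere_borel_prob (A \<inter> sphere 0 1)"
  by (simp add: cone_vol_def sphere_prob_def measure_completion sets_sphere_borel_prob_Int)

text \<open>Invariance passes from the Borel measure to its completion; this is needed since integrands
  built from \<open>\<eta>\<close> are only known to be measurable for the completion.\<close>

lemma distr_sphere_prob_rotation:
  fixes g :: "real^'d^'d"
  assumes "rotation_matrix g"
  shows "(*v) g \<in> measurable sphere_prob sphere_prob"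
    and "distr sphere_prob sphere_prob ((*v) g) = sphere_prob"
proof -
  have "linear ((*v) g)" by simp
  then have gb: "(*v) g \<in> borel_measurable borel"
    by (intro borel_measurable_continuous_onI linear_continuous_on)
      (simp add: linear_conv_bounded_linear)
  have ot: "orthogonal_transformation ((*v) g)"
    using assms by (simp add: rotation_matrix_def orthogonal_transformation_matrix)
  have "norm (g *v x) = norm x" for x
    using ot orthogonal_transformation_norm by blast
  with gb have g: "(*v) g \<in> measurable sphere_borel_prob sphere_borel_prob"
    by (subst measurable_cong_sets[OF sets_sphere_borel_prob sets_sphere_borel_prob])
      (auto intro!: measurable_restrict_space3)
  then have g': "(*v) g \<in> measurable sphere_prob sphere_borel_prob"
    unfolding sphere_prob_def by (rule measurable_completion)
  have eq: "distr sphere_prob sphere_borel_prob ((*v) g) = sphere_borel_prob"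
    using g by (simp add: sphere_prob_def distr_completion rotation_invariant_sphere_borel_prob[OF assms])
  show "(*v) g \<in> measurable sphere_prob sphere_prob"
    using completion.measurable_completion2[OF g'[unfolded sphere_prob_def]] eq
    by (simp add: sphere_prob_def)
  show "distr sphere_prob sphere_prob ((*v) g) = sphere_prob"
    using completion.completion_distr_eq[OF g'[unfolded sphere_prob_def]] eq
    by (simp add: sphere_prob_def)
qed

lemma null_sets_sphere_hyperplane:
  fixes h :: "real^'d"
  assumes "h \<noteq> 0"
  shows "{y. h \<bullet> y = 0} \<inter> sphere 0 1 \<in> null_sets sphere_borel_prob"
proof -
  let ?H = "{y. h \<bullet> y = 0}"
  have H: "?H \<in> sets borel" by (rule borel_closed[OF closed_hyperplane])
  have "negligible ?H" using assms by (intro negligible_hyperplane) simp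
  then have "emeasure lborel ?H = 0"
    using H by (simp add: negligible_iff_null_sets null_sets_completion_iff null_sets_def)
  moreover have "cball 0 1 \<inter> sgn -` (?H \<inter> sphere 0 1) \<subseteq> ?H"
    by (auto simp: sgn_div_norm)
  ultimately have "emeasure lborel (cball 0 1 \<inter> sgn -` (?H \<inter> sphere 0 1)) = 0"
    using emeasure_mono[of _ ?H lborel] H by (metis le_zero_eq sets_lborel)
  then show ?thesis
    using H sets_sphere_borel_prob_Int[OF H] sphere_borel_closed[where 'd='d]
    by (intro null_setsI) (auto simp: emeasure_sphere_borel_prob)
qed

lemma AE_sphere_not_hyperplane:
  fixes h :: "real^'d"
  assumes "h \<noteq> 0"
  shows "AE x in sphere_prob. h \<bullet> x \<noteq> 0"
proof -
  have "AE x in sphere_borel_prob. x \<notin> {y. h \<bullet> y = 0} \<inter> sphere 0 1"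
    by (rule AE_not_in[OF null_sets_sphere_hyperplane[OF assms]])
  then have "AE x in sphere_borel_prob. h \<bullet> x \<noteq> 0"
    using AE_space by eventually_elim (auto simp: space_sphere_borel_prob)
  then show ?thesis unfolding sphere_prob_def by (rule AE_completion)
qed

lemma cone_vol_in_hyperplane:
  assumes "h \<noteq> 0" "A \<subseteq> {y. h \<bullet> y = 0}" "A \<in> sets borel"
  shows "cone_vol A = 0"
proof -
  have "A \<inter> sphere 0 1 \<in> null_sets sphere_borel_prob"
    using assms(2) by (intro null_sets_subset[OF null_sets_sphere_hyperplane[OF assms(1)]
          sets_sphere_borel_prob_Int[OF assms(3)]]) auto
  then show ?thesis using assms(3) by (simp add: cone_vol_eq measure_def null_setsD1)
qed

lemma cone_vol_Un:
  fixes A B :: "(real^'d) set"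
  assumes "A \<in> sets borel" "B \<in> sets borel"
  shows "cone_vol (A \<union> B) = cone_vol A + cone_vol B - cone_vol (A \<inter> B)"
proof -
  interpret prob_space "sphere_borel_prob :: (real^'d) measure" by (rule prob_space_sphere_borel_prob)
  let ?S = "sphere (0::real^'d) 1"
  have "(A \<union> B) \<inter> ?S = (A \<inter> ?S) \<union> (B \<inter> ?S)" "(A \<inter> B) \<inter> ?S = (A \<inter> ?S) \<inter> (B \<inter> ?S)" by auto
  then show ?thesis
    using assms measure_Un3[of "A \<inter> ?S" sphere_borel_prob "B \<inter> ?S"]
    by (simp add: cone_vol_eq fmeasurable_eq_sets sets_sphere_borel_prob_Int)
qed

lemma cone_vol_UNIV: "cone_vol (UNIV :: (real^'d) set) = 1"
  using prob_space.prob_space[OF prob_space_sphere_borel_prob[where 'd='d]]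
  by (simp add: cone_vol_eq space_sphere_borel_prob)

text \<open>The antipodal map is a rotation in even dimensions only, so rotation invariance does not
  yield this.\<close>

lemma cone_vol_uminus:
  fixes A :: "(real^'d) set"
  assumes "A \<in> sets borel"
  shows "cone_vol (uminus -` A) = cone_vol A"
proof -
  let ?S = "sphere (0::real^'d) 1" and ?B = "cball (0::real^'d) 1"
  have um: "(uminus :: real^'d \<Rightarrow> real^'d) \<in> borel_measurable borel" by simp
  have A': "uminus -` A \<in> sets borel" using measurable_sets[OF um assms] by simp
  have AS: "A \<inter> ?S \<in> sets borel" using assms sphere_borel_closed by blast
  have T: "?B \<inter> sgn -` (A \<inter> ?S) \<in> sets borel"
    using measurable_sets[OF borel_measurable_sgn AS] by auto
  have "?B \<inter> sgn -` (uminus -` A \<inter> ?S) = uminus -` (?B \<inter> sgn -` (A \<inter> ?S))"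
    by (auto simp: sgn_minus)
  then have "emeasure lborel (?B \<inter> sgn -` (uminus -` A \<inter> ?S))
      = emeasure (distr lborel borel uminus) (?B \<inter> sgn -` (A \<inter> ?S))"
    using T um by (simp add: emeasure_distr)
  also have "distr lborel borel (uminus :: real^'d \<Rightarrow> real^'d) = lborel"
    by (rule lborel_distr_orthogonal) (simp add: orthogonal_transformation_neg orthogonal_transformation_id)
  finally show ?thesis
    using A' assms AS sphere_borel_closed[where 'd='d]
    by (simp add: cone_vol_eq measure_def emeasure_sphere_borel_prob)
qed

section \<open>Reflections\<close>

lemma frame_det_matrix_mult:
  "frame_det (\<lambda>i. M *v w i) = det M * frame_det w"
proof -
  have "(\<chi> i. M *v w i) = (\<chi> i. w i) ** transpose M"
    by (simp add: vec_eq_iff matrix_vector_mult_def matrix_matrix_mult_def transpose_def mult.commute)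
  then show ?thesis by (simp add: frame_det_def det_mul)
qed

lemma frame_cone_matrix_mult:
  "frame_cone (\<lambda>i. M *v w i) = (*v) M ` frame_cone w"
proof -
  have "(\<Sum>i\<in>UNIV. c i *\<^sub>R (M *v w i)) = M *v (\<Sum>i\<in>UNIV. c i *\<^sub>R w i)" for c
    by (simp add: matrix_vector_mult_scaleR linear_sum[OF matrix_vector_mul_linear])
  then show ?thesis unfolding frame_cone_def by auto
qed

definition reflection_along :: "real^'d \<Rightarrow> real^'d \<Rightarrow> real^'d" where
  "reflection_along m x = x - (2 * (m \<bullet> x) / (m \<bullet> m)) *\<^sub>R m"

lemma reflection_along_linear: "linear (reflection_along m)"
  unfolding reflection_along_def
  by (rule linearI) (simp_all add: inner_right_distrib algebra_simps add_divide_distrib)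

lemma reflection_along_fixed: "m \<bullet> x = 0 \<Longrightarrow> reflection_along m x = x"
  by (simp add: reflection_along_def)

lemma reflection_along_orthogonal:
  assumes "m \<noteq> 0"
  shows "orthogonal_transformation (reflection_along m)"
proof -
  have "reflection_along m x \<bullet> reflection_along m y = x \<bullet> y" for x y
    using assms by (simp add: reflection_along_def inner_diff_left inner_diff_right inner_commute[of x m] inner_commute[of y m] field_simps)
  then show ?thesis
    using reflection_along_linear by (simp add: orthogonal_transformation_def)
qed

lemma matrix_reflection_along: "matrix (reflection_along m) *v x = reflection_along m x"
  using matrix_works[of "reflection_along m" x] reflection_along_linear[of m]
  by (simp add: linear_matrix_vector_mul_eq)

text \<open>In an orthonormal frame that contains the direction of \<open>m\<close>, the reflection changes the sign of one
  vector and fixes the others.\<close>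

lemma det_reflection_along:
  fixes m :: "real^'d"
  assumes "m \<noteq> 0"
  shows "det (matrix (reflection_along m)) = - 1"
proof -
  let ?u = "(1 / norm m) *\<^sub>R m" and ?k = "undefined :: 'd"
  have "norm ?u = 1" using assms by simp
  then obtain A :: "real^'d^'d" where A: "orthogonal_matrix A" "A *v (axis ?k 1) = ?u"
    using orthogonal_matrix_exists_basis[of ?u ?k] by metis
  define w where "w i = A *v axis i 1" for i
  have mw: "m = norm m *\<^sub>R w ?k" using assms A(2) by (simp add: w_def)
  have ww: "w i \<bullet> w j = axis i 1 \<bullet> (axis j 1 :: real^'d)" for i j
    using A(1) orthogonal_transformation_matrix[of "(*v) A"]
    by (simp add: w_def orthogonal_transformation_def)
  have "reflection_along m (w i) = (w(?k := - w ?k)) i" for i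
  proof (cases "i = ?k")
    case True
    have "reflection_along m m = - m" using assms by (simp add: reflection_along_def scaleR_2)
    then have "norm m *\<^sub>R reflection_along m (w ?k) = norm m *\<^sub>R (- w ?k)"
      using mw linear_scale[OF reflection_along_linear, of m "norm m" "w ?k"] by simp
    then have "norm m *\<^sub>R (reflection_along m (w ?k) + w ?k) = 0"
      by (simp add: scaleR_right_distrib)
    then have "reflection_along m (w ?k) = - w ?k" using assms by (simp add: eq_neg_iff_add_eq_0)
    then show ?thesis using True by simp
  next
    case False
    have "m \<bullet> w i = 0"
      using False by (subst mw) (simp add: ww inner_axis_axis)
    then show ?thesis using False by (simp add: reflection_along_fixed)
  qed
  then have "det (matrix (reflection_along m)) * frame_det w = frame_det (w(?k := - w ?k))"
    by (simp flip: frame_det_matrix_mult add: matrix_reflection_along del: fun_upd_apply)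
  also have "\<dots> = - frame_det w"
    using frame_det_upd_scale[of w ?k "- 1" "w ?k"] by simp
  finally have "det (matrix (reflection_along m)) * frame_det w = - 1 * frame_det w" by simp
  moreover have "frame_det w \<noteq> 0"
  proof -
    have "frame_det w = det A * frame_det (\<lambda>i::'d. axis i 1)"
      unfolding w_def by (rule frame_det_matrix_mult)
    also have "frame_det (\<lambda>i::'d. axis i 1) = 1"
    proof -
      have "(\<chi> i. axis i 1) = (mat 1 :: real^'d^'d)"
        by (auto simp: vec_eq_iff mat_def axis_def)
      then show ?thesis by (simp add: frame_det_def)
    qed
    finally show ?thesis using det_orthogonal_matrix[OF A(1)] by auto
  qed
  ultimately show ?thesis by (simp only: mult_cancel_right) simp
qed

lemma rotation_two_reflections:
  fixes m n :: "real^'d"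
  assumes "m \<noteq> 0" "n \<noteq> 0"
  obtains g where "rotation_matrix g" "\<And>x. g *v x = reflection_along m (reflection_along n x)"
proof
  let ?g = "matrix (reflection_along m) ** matrix (reflection_along n)"
  show "rotation_matrix ?g"
    using assms by (auto simp: rotation_matrix_def det_mul det_reflection_along
        intro!: orthogonal_matrix_mul orthogonal_transformation_matrix[THEN iffD1, THEN conjunct2] reflection_along_orthogonal)
  show "?g *v x = reflection_along m (reflection_along n x)" for x
    by (simp add: matrix_reflection_along flip: matrix_vector_mul_assoc)
qed

section \<open>Facets and their means\<close>

definition facet_cone :: "('d::finite \<Rightarrow> real^'d) \<Rightarrow> 'd \<Rightarrow> (real^'d) set" where
  "facet_cone v i = {\<Sum>j\<in>UNIV-{i}. c j *\<^sub>R v j | c. \<forall>j. 0 \<le> c j}"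

lemma facet_cone_simplicial:
  fixes v :: "'d::finite \<Rightarrow> real^'d"
  assumes "frame_det v \<noteq> 0"
  shows "pointed_simplicial_cone (facet_cone v i)" "dim (facet_cone v i) = CARD('d) - 1"
proof -
  let ?B = "v ` (UNIV - {i})"
  have inj: "inj_on v (UNIV - {i})" using frame_independent(1)[OF assms] by (rule inj_on_subset) auto
  have ind: "independent ?B" by (rule independent_mono[OF frame_independent(2)[OF assms]]) auto
  have eq: "facet_cone v i = {\<Sum>b\<in>?B. u b *\<^sub>R b | u. \<forall>b\<in>?B. (0::real) \<le> u b}"
  proof (intro set_eqI iffI)
    fix x assume "x \<in> facet_cone v i"
    then obtain c where c: "x = (\<Sum>j\<in>UNIV-{i}. c j *\<^sub>R v j)" "\<forall>j. 0 \<le> c j"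
      by (auto simp: facet_cone_def)
    then have "x = (\<Sum>b\<in>?B. c (inv_into (UNIV - {i}) v b) *\<^sub>R b)"
      using inj by (simp add: sum.reindex inv_into_f_f)
    then show "x \<in> {\<Sum>b\<in>?B. u b *\<^sub>R b | u. \<forall>b\<in>?B. (0::real) \<le> u b}"
      using c(2) by (intro CollectI exI[of _ "\<lambda>b. c (inv_into (UNIV - {i}) v b)"]) auto
  next
    fix x assume "x \<in> {\<Sum>b\<in>?B. u b *\<^sub>R b | u. \<forall>b\<in>?B. (0::real) \<le> u b}"
    then obtain u where u: "x = (\<Sum>b\<in>?B. u b *\<^sub>R b)" "\<forall>b\<in>?B. 0 \<le> u b" by blast
    then have "x = (\<Sum>j\<in>UNIV-{i}. max 0 (u (v j)) *\<^sub>R v j)"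
      using inj by (simp add: sum.reindex max_absorb2)
    then show "x \<in> facet_cone v i"
      unfolding facet_cone_def by (intro CollectI exI[of _ "\<lambda>j. max 0 (u (v j))"]) auto
  qed
  show "pointed_simplicial_cone (facet_cone v i)"
    unfolding pointed_simplicial_cone_def using ind eq by (intro exI[of _ ?B]) auto
  show "dim (facet_cone v i) = CARD('d) - 1"
  proof (rule dim_unique[OF _ _ ind])
    show "?B \<subseteq> facet_cone v i"
    proof
      fix x assume "x \<in> ?B"
      then obtain j where j: "x = v j" "j \<noteq> i" by auto
      have "x = (\<Sum>k\<in>UNIV-{i}. (if k = j then 1 else 0) *\<^sub>R v k)"
        using j by (simp add: if_distrib[of "\<lambda>c. c *\<^sub>R _"] cong: if_cong)
      then show "x \<in> facet_cone v i"
        unfolding facet_cone_def by (intro CollectI exI[of _ "\<lambda>k. if k = j then 1 else 0"]) auto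
    qed
    show "facet_cone v i \<subseteq> span ?B"
      unfolding facet_cone_def by (auto intro!: span_sum span_scale intro: span_base)
    show "card ?B = CARD('d) - 1" using inj by (simp add: card_image)
  qed
qed

lemma add_ray_facet_cone: "add_ray (facet_cone v i) x = frame_cone (v(i := x))"
proof (intro set_eqI iffI)
  fix y assume "y \<in> add_ray (facet_cone v i) x"
  then obtain c t where c: "\<forall>j. 0 \<le> c j" "0 \<le> t" "y = (\<Sum>j\<in>UNIV-{i}. c j *\<^sub>R v j) + t *\<^sub>R x"
    by (auto simp: add_ray_def facet_cone_def)
  have "(\<Sum>j\<in>UNIV-{i}. (c(i := t)) j *\<^sub>R v j) = (\<Sum>j\<in>UNIV-{i}. c j *\<^sub>R v j)"
    by (intro sum.cong) auto
  then have "y = (\<Sum>j\<in>UNIV. (c(i := t)) j *\<^sub>R (v(i := x)) j)"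
    using c(3) frame_sum_upd[of "c(i := t)" v i x] by (simp add: add.commute)
  then show "y \<in> frame_cone (v(i := x))"
    unfolding frame_cone_def using c(1,2) by (intro CollectI exI[of _ "c(i := t)"]) auto
next
  fix y assume "y \<in> frame_cone (v(i := x))"
  then obtain c where c: "\<forall>j. 0 \<le> c j" "y = c i *\<^sub>R x + (\<Sum>j\<in>UNIV-{i}. c j *\<^sub>R v j)"
    unfolding frame_cone_def frame_sum_upd by blast
  then show "y \<in> add_ray (facet_cone v i) x"
    unfolding add_ray_def facet_cone_def
    by (intro CollectI exI[of _ "\<Sum>j\<in>UNIV-{i}. c j *\<^sub>R v j"] exI[of _ "c i"] conjI exI[of _ c])
      (auto simp: add.commute)
qed

lemma frame_det_upd_span_facet:
  assumes "x \<in> span (facet_cone v i)"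
  shows "frame_det (v(i := x)) = 0"
proof -
  have "frame_det (v(i := y)) = 0" if y: "y \<in> facet_cone v i" for y
  proof -
    obtain c where c: "y = (\<Sum>j\<in>UNIV-{i}. c j *\<^sub>R v j)"
      using y unfolding facet_cone_def by blast
    have "y = (\<Sum>j\<in>UNIV. (c(i := 0)) j *\<^sub>R v j)"
      unfolding c by (rule sum.mono_neutral_cong_left) auto
    then show ?thesis using frame_det_upd_sum[of v i "c(i := 0)"] by (simp only: fun_upd_same mult_zero_left)
  qed
  then show ?thesis
    by (rule linear_eq_0_on_span[OF linear_frame_det_upd _ assms])
qed

locale integrable_cone_valuation = simple_cone_valuation \<eta>
  for \<eta> :: "(real^'d) set \<Rightarrow> real" +
  assumes card_ge_2: "CARD('d) \<ge> 2"
    and SO_invariant: "SO_invariant_on nonzero_pointed_polyhedral_cones \<eta>"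
    and integrable_add_ray: "pointed_simplicial_cone F \<Longrightarrow> dim F = CARD('d) - 1 \<Longrightarrow>
           set_integrable sphere_prob (sphere 0 1 - span F) (\<lambda>x. \<eta> (add_ray F x))"
begin

lemma oriented_rotation:
  assumes g: "rotation_matrix g"
  shows "oriented (\<lambda>i. g *v w i) = oriented w"
proof -
  have "frame_det (\<lambda>i. g *v w i) = frame_det w"
    using g by (simp add: frame_det_matrix_mult rotation_matrix_def)
  then show ?thesis
    using SO_invariant g frame_cone_mem[of w]
    by (cases "frame_det w = 0") (simp_all add: oriented_def frame_cone_matrix_mult SO_invariant_on_def)
qed

text \<open>The integrability assumption speaks of points off the span of the facet; on that span
  \<open>oriented (v(i := x))\<close> vanishes because the frame is degenerate.\<close>

lemma integrable_oriented:
  assumes v: "frame_det v \<noteq> 0"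
  shows "integrable sphere_prob (\<lambda>x. oriented (v(i := x)))"
proof -
  let ?F = "facet_cone v i"
  let ?f = "\<lambda>x. indicator (sphere 0 1 - span ?F) x *\<^sub>R \<eta> (add_ray ?F x)"
  have f: "integrable sphere_prob ?f"
    using integrable_add_ray[OF facet_cone_simplicial[OF v]] by (simp add: set_integrable_def)
  have "(\<lambda>x. frame_det (v(i := x))) \<in> borel_measurable borel"
    using linear_frame_det_upd
    by (intro borel_measurable_continuous_onI linear_continuous_on)
      (simp add: linear_conv_bounded_linear)
  then have "(\<lambda>x. sgn (frame_det (v(i := x)))) \<in> borel_measurable sphere_prob"
    by (intro borel_measurable_sphere_prob) simp
  then have m: "(\<lambda>x. sgn (frame_det (v(i := x))) * ?f x) \<in> borel_measurable sphere_prob"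
    using f by (intro borel_measurable_times) auto
  have "integrable sphere_prob (\<lambda>x. sgn (frame_det (v(i := x))) * ?f x)"
    by (rule Bochner_Integration.integrable_bound[OF f m])
      (auto simp: abs_mult sgn_real_def)
  moreover have "sgn (frame_det (v(i := x))) * ?f x = oriented (v(i := x))" if "x \<in> space sphere_prob" for x
    using that frame_det_upd_span_facet[of x v i]
    by (cases "x \<in> span ?F") (auto simp: oriented_def space_sphere_prob add_ray_facet_cone)
  ultimately show ?thesis
    using Bochner_Integration.integrable_cong[OF refl] by (metis (no_types, lifting))
qed

definition facet_mean :: "('d \<Rightarrow> real^'d) \<Rightarrow> 'd \<Rightarrow> real" where
  "facet_mean v i = (\<integral>x. oriented (v(i := x)) \<partial>sphere_prob)"

text \<open>The expectation of the cocycle identity in \<open>x\<close>.  For almost all \<open>x\<close> no coordinate is zero, so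
  either some coordinate is positive and the defect is zero, or \<open>x\<close> lies in the cone opposite to that
  of \<open>v\<close> and the defect is the total of a complete fan.\<close>

lemma oriented_eq_facet_means:
  assumes v: "frame_det v \<noteq> 0"
  shows "oriented v = (\<Sum>i\<in>UNIV. facet_mean v i) + sgn (frame_det v) * fan_total v * cone_vol (frame_cone v)"
proof -
  interpret prob_space "sphere_prob :: (real^'d) measure" by (rule prob_space_sphere_prob)
  let ?C = "uminus -` frame_cone v"
  let ?k = "sgn (frame_det v) * fan_total v"
  have Cb: "frame_cone v \<in> sets borel"
    by (rule borel_closed[OF polyhedral_cone_closed[OF frame_cone_polyhedral[OF v]]])
  have C: "?C \<in> sets borel"
    using measurable_sets[OF borel_measurable_uminus[OF measurable_ident] Cb] by simp
  have CS: "?C \<inter> sphere 0 1 \<in> sets sphere_prob"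
    using sets_sphere_borel_prob_Int[OF C] by (simp add: sphere_prob_def)
  have "frame_dual v i \<noteq> 0" for i
    using frame_coord_self[OF v, of i i] by (auto simp: frame_coord_eq_inner)
  then have "AE x in sphere_prob. \<forall>i. frame_coord v i x \<noteq> 0"
    unfolding frame_coord_eq_inner AE_all_countable using AE_sphere_not_hyperplane by blast
  then have AE: "AE x in sphere_prob. oriented v =
      (\<Sum>i\<in>UNIV. oriented (v(i := x))) + ?k * indicator (?C \<inter> sphere 0 1) x"
    using AE_space
  proof eventually_elim
    case (elim x)
    have C_iff: "x \<in> ?C \<longleftrightarrow> (\<forall>i. frame_coord v i x < 0)"
      using elim(1) by (auto simp: frame_cone_iff[OF v] linear_neg[OF linear_frame_coord] less_le)
    have "fan_defect v x = ?k * indicator (?C \<inter> sphere 0 1) x"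
    proof (cases "\<forall>i. frame_coord v i x < 0")
      case True
      then have "x \<in> ?C \<inter> sphere 0 1" using C_iff elim(2) by (simp add: space_sphere_prob)
      then show ?thesis using fan_defect_negative[OF v] True by simp
    next
      case False
      then obtain p where "0 < frame_coord v p x" using elim(1) by (metis linorder_neqE)
      then show ?thesis using fan_defect_eq_0[OF v] False C_iff by simp
    qed
    then show ?case by (simp add: fan_defect_def)
  qed
  have int: "integrable sphere_prob (\<lambda>x. oriented (v(i := x)))" for i
    by (rule integrable_oriented[OF v])
  have int2: "integrable sphere_prob (\<lambda>x. ?k * indicator (?C \<inter> sphere 0 1) x :: real)"
    using CS by (intro integrable_mult_right integrable_real_indicator) (auto simp: emeasure_eq_measure)
  have "oriented v = (\<integral>x. oriented v \<partial>(sphere_prob :: (real^'d) measure))"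
    using prob_space by simp
  also have "\<dots> = (\<integral>x. (\<Sum>i\<in>UNIV. oriented (v(i := x))) + ?k * indicator (?C \<inter> sphere 0 1) x \<partial>sphere_prob)"
    using int int2 by (intro integral_cong_AE AE) auto
  also have "\<dots> = (\<Sum>i\<in>UNIV. facet_mean v i) + ?k * measure sphere_prob (?C \<inter> sphere 0 1)"
    using int int2 CS sets.sets_into_space[OF CS]
    by (simp add: Bochner_Integration.integral_add Bochner_Integration.integral_sum facet_mean_def Int_absorb1)
  also have "measure sphere_prob (?C \<inter> sphere 0 1) = cone_vol (frame_cone v)"
    using cone_vol_uminus[OF Cb] by (simp add: cone_vol_def)
  finally show ?thesis .
qed

text \<open>Here \<open>n i\<close> is the inward unit normal of facet \<open>i\<close>, \<open>c\<close> the centre of the inscribed ball of radius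
  one, and \<open>f i\<close> the point where this ball touches facet \<open>i\<close>.  The coordinate of \<open>f i\<close> at \<open>v k\<close> is a
  positive multiple of \<open>1 - n k \<bullet> n i\<close>, hence \<open>f i\<close> is in the relative interior of its facet.\<close>

lemma sum_facet_means:
  assumes v: "frame_det v \<noteq> 0"
  shows "(\<Sum>i\<in>UNIV. facet_mean v i) = 0"
proof -
  define r where "r i = norm (frame_dual v i)" for i
  define n where "n i = (1 / r i) *\<^sub>R frame_dual v i" for i
  define c where "c = (\<Sum>i\<in>UNIV. r i *\<^sub>R v i)"
  define f where "f i = c - n i" for i
  have "frame_dual v i \<noteq> 0" for i
    using frame_coord_self[OF v, of i i] by (auto simp: frame_coord_eq_inner)
  then have r: "0 < r i" for i by (simp add: r_def)
  have dual_n: "frame_dual v i = r i *\<^sub>R n i" for i using r[of i] by (simp add: n_def)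
  have nn: "n i \<bullet> n i = 1" for i
    using r[of i] by (simp add: n_def r_def power2_norm_eq_inner[symmetric] power2_eq_square)
  have nv: "n i \<bullet> v j = (if i = j then 1 / r i else 0)" for i j
    using frame_coord_self[OF v, of i j] by (simp add: n_def frame_coord_eq_inner)
  have nc: "n i \<bullet> c = 1" for i
    using r[of i] unfolding c_def by (simp add: inner_sum_right nv if_distrib[of "\<lambda>t. _ * t"] cong: if_cong)
  have n_neq: "n i - n j \<noteq> 0" if "i \<noteq> j" for i j
    using nv[of i i] nv[of j i] that r[of i] by auto
  have n_less: "n i \<bullet> n j < 1" if "i \<noteq> j" for i j
  proof -
    have "0 < (n i - n j) \<bullet> (n i - n j)" using n_neq[OF that] by simp
    then show ?thesis by (simp add: inner_diff_left inner_diff_right nn inner_commute[of "n j"])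
  qed
  have f_coord: "frame_coord v k (f i) = r k * (1 - n k \<bullet> n i)" for k i
    by (simp add: frame_coord_eq_inner dual_n f_def inner_diff_right nc algebra_simps)
  then have f_zero: "frame_coord v i (f i) = 0" and
      f_pos: "k \<noteq> i \<Longrightarrow> 0 < frame_coord v k (f i)" for k i
    using nn n_less r by simp_all
  have f_frame: "frame_det (v(j := f i)) \<noteq> 0" if "j \<noteq> i" for i j
    using v f_pos[OF that] by (simp add: frame_det_eq_coord)
  \<comment> \<open>Stellar subdivision of facet \<open>i\<close> at \<open>f i\<close>, carried out in the cone over that facet with apex
    ray \<open>x\<close>.  Dimension at least two ensures that some coordinate of \<open>f i\<close> is positive.\<close>
  have subdivide: "oriented (v(i := x)) = (\<Sum>j\<in>UNIV-{i}. oriented (v(j := f i, i := x)))" for i x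
  proof -
    obtain p where p: "p \<noteq> i"
    proof -
      have "UNIV \<noteq> {i}" using card_ge_2 by (auto dest: arg_cong[where f = card])
      then show ?thesis using that by auto
    qed
    have "f i = (\<Sum>k\<in>UNIV. frame_coord v k (f i) *\<^sub>R v k)"
      by (rule frame_expansion[OF v])
    also have "\<dots> = (\<Sum>k\<in>UNIV. frame_coord v k (f i) *\<^sub>R (v(i := x)) k)"
      by (intro sum.cong) (auto simp: f_zero)
    finally have "oriented (v(i := x)) = (\<Sum>j\<in>UNIV. oriented (v(i := x, j := f i)))"
      by (intro oriented_subdivision[of "\<lambda>k. frame_coord v k (f i)" p]) (rule f_pos[OF p])
    also have "\<dots> = oriented (v(i := x, i := f i)) + (\<Sum>j\<in>UNIV-{i}. oriented (v(i := x, j := f i)))"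
      by (rule sum.remove) auto
    also have "oriented (v(i := x, i := f i)) = 0"
      using v f_zero[of i] by (intro oriented_eq_0) (simp add: frame_det_eq_coord)
    also have "(\<Sum>j\<in>UNIV-{i}. oriented (v(i := x, j := f i))) = (\<Sum>j\<in>UNIV-{i}. oriented (v(j := f i, i := x)))"
      by (intro sum.cong) (auto simp: fun_upd_twist)
    finally show ?thesis by (simp del: fun_upd_apply)
  qed
  have "facet_mean v i = (\<Sum>j\<in>UNIV-{i}. facet_mean (v(j := f i)) i)" for i
  proof -
    have "facet_mean v i = (\<integral>x. (\<Sum>j\<in>UNIV-{i}. oriented (v(j := f i, i := x))) \<partial>sphere_prob)"
      unfolding facet_mean_def by (subst subdivide) (rule refl)
    also have "\<dots> = (\<Sum>j\<in>UNIV-{i}. facet_mean (v(j := f i)) i)"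
      unfolding facet_mean_def by (rule Bochner_Integration.integral_sum) (use integrable_oriented[OF f_frame] in blast)
    finally show ?thesis .
  qed
  then have "(\<Sum>i\<in>UNIV. facet_mean v i) = (\<Sum>i\<in>UNIV. \<Sum>j\<in>UNIV-{i}. facet_mean (v(j := f i)) i)"
    by simp
  also have "\<dots> = 0"
  proof (rule sum_antisymmetric_offdiagonal)
    fix i j :: 'd assume ij: "i \<noteq> j"
    \<comment> \<open>The reflection along \<open>n i - n j\<close> exchanges the hyperplanes of the facets \<open>i\<close> and \<open>j\<close>; the one along \<open>n i\<close>, which
      is applied first, fixes facet \<open>i\<close> pointwise and corrects the orientation.\<close>
    let ?m = "n i - n j"
    have "n i \<noteq> 0" using nn[of i] by auto
    then obtain g where g: "rotation_matrix g"
        "\<And>x. g *v x = reflection_along ?m (reflection_along (n i) x)"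
      using rotation_two_reflections[OF n_neq[OF ij]] by metis
    have gv: "g *v v k = v k" if "k \<noteq> i" "k \<noteq> j" for k
      using that by (simp add: g(2) reflection_along_fixed nv inner_diff_left)
    have gf: "g *v f i = f j"
    proof -
      have "n i \<bullet> f i = 0" by (simp add: f_def inner_diff_right nn nc)
      then have "g *v f i = reflection_along ?m (f i)" by (simp add: g(2) reflection_along_fixed)
      moreover have "2 * (?m \<bullet> f i) / (?m \<bullet> ?m) = - 1"
        using n_less[OF ij]
        by (simp add: f_def inner_diff_left inner_diff_right nn nc inner_commute[of "n j"] field_simps)
      ultimately show ?thesis by (simp add: reflection_along_def f_def)
    qed
    let ?h = "\<lambda>x. oriented (v(j := f j, i := x))"
    have h: "?h x = - oriented (v(i := f j, j := x))" for x
      using oriented_swap[OF not_sym[OF ij], of v "f j" x] ij by (simp add: fun_upd_twist)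
    have "oriented (v(j := f i, i := x)) = ?h (g *v x)" for x
    proof -
      have "(\<lambda>k. g *v (v(j := f i, i := x)) k) = v(j := f j, i := g *v x)"
        using gv gf by auto
      then show ?thesis using oriented_rotation[OF g(1), of "v(j := f i, i := x)"] by simp
    qed
    then have "facet_mean (v(j := f i)) i = (\<integral>x. ?h (g *v x) \<partial>sphere_prob)"
      by (simp add: facet_mean_def)
    also have "\<dots> = (\<integral>x. ?h x \<partial>distr sphere_prob sphere_prob ((*v) g))"
    proof (rule integral_distr[symmetric])
      show "(*v) g \<in> measurable sphere_prob sphere_prob"
        by (rule distr_sphere_prob_rotation(1)[OF g(1)])
      show "?h \<in> borel_measurable sphere_prob"
        unfolding h using integrable_oriented[OF f_frame[OF ij]] by auto
    qed
    also have "\<dots> = - facet_mean (v(i := f j)) j"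
      unfolding distr_sphere_prob_rotation(2)[OF g(1)] h by (simp add: facet_mean_def)
    finally show "facet_mean (v(j := f i)) i = - facet_mean (v(i := f j)) j" .
  qed
  finally show ?thesis .
qed

lemma eta_frame_cone:
  assumes v: "frame_det v \<noteq> 0"
  shows "\<eta> (frame_cone v) = fan_total (\<lambda>i. axis i 1) * cone_vol (frame_cone v)"
proof -
  have "sgn (frame_det v) * \<eta> (frame_cone v)
      = sgn (frame_det v) * (fan_total (\<lambda>i. axis i 1) * cone_vol (frame_cone v))"
    using oriented_eq_facet_means[OF v] sum_facet_means[OF v] fan_total_const[OF v]
    by (simp add: oriented_def)
  then show ?thesis using v by (simp add: sgn_eq_0_iff)
qed

end

section \<open>From simplicial cones to polyhedral cones\<close>

lemma orthant_frame:
  fixes s :: "'d::finite \<Rightarrow> real"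
  assumes "\<And>k. s k = 1 \<or> s k = - 1"
  shows "frame_det (\<lambda>k. s k *\<^sub>R axis k 1) \<noteq> 0"
    and "frame_cone (\<lambda>k. s k *\<^sub>R axis k 1) = {y. \<forall>k. 0 \<le> s k * y $ k}"
proof -
  let ?v = "\<lambda>k::'d. s k *\<^sub>R axis k (1::real)"
  have ss: "s k * s k = 1" for k using assms[of k] by auto
  have "frame_det ?v = (\<Prod>k\<in>UNIV. s k)"
    unfolding frame_det_def by (subst det_diagonal) (auto simp: axis_def)
  then show "frame_det ?v \<noteq> 0" using ss by (auto simp: prod_zero_iff) (metis mult_zero_left zero_neq_one)
  have sum: "(\<Sum>k\<in>UNIV. c k *\<^sub>R ?v k) $ l = c l * s l" for c l
    by (simp add: axis_def if_distrib[of "\<lambda>t. _ * t"] cong: if_cong)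
  show "frame_cone ?v = {y. \<forall>k. 0 \<le> s k * y $ k}"
  proof (intro set_eqI iffI)
    fix y assume "y \<in> frame_cone ?v"
    then obtain c where c: "\<forall>k. 0 \<le> c k" "y = (\<Sum>k\<in>UNIV. c k *\<^sub>R ?v k)"
      unfolding frame_cone_def by blast
    have "s k * y $ k = c k * (s k * s k)" for k unfolding c(2) sum by simp
    then show "y \<in> {y. \<forall>k. 0 \<le> s k * y $ k}" using c(1) ss by simp
  next
    fix y assume y: "y \<in> {y. \<forall>k. 0 \<le> s k * y $ k}"
    have "y = (\<Sum>k\<in>UNIV. (s k * y $ k) *\<^sub>R ?v k)"
      unfolding vec_eq_iff sum using ss by (simp add: algebra_simps)
    then show "y \<in> frame_cone ?v"
      unfolding frame_cone_def using y by (intro CollectI exI[of _ "\<lambda>k. s k * y $ k"]) auto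
  qed
qed

text \<open>The family \<open>D\<close> is left open, since the principle is needed both for pointed cones and for all
  polyhedral cones.  For pointed cones \<open>D\<close> must contain the zero cone as well, in order to be
  closed under subcones.\<close>

locale frame_null_functional =
  fixes D :: "(real^'d) set set" and \<theta> :: "(real^'d) set \<Rightarrow> real"
  assumes polyhedral: "D \<subseteq> polyhedral_cones"
    and subcone: "C \<in> D \<Longrightarrow> C' \<in> polyhedral_cones \<Longrightarrow> C' \<subseteq> C \<Longrightarrow> C' \<in> D"
    and cut: "C\<^sub>1 \<in> D \<Longrightarrow> C\<^sub>2 \<in> D \<Longrightarrow> C\<^sub>1 \<union> C\<^sub>2 \<in> D \<Longrightarrow> h \<noteq> 0 \<Longrightarrow>
      C\<^sub>1 \<inter> C\<^sub>2 \<subseteq> {y. h \<bullet> y = 0} \<Longrightarrow> \<theta> (C\<^sub>1 \<union> C\<^sub>2) = \<theta> C\<^sub>1 + \<theta> C\<^sub>2"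
    and null: "C \<in> D \<Longrightarrow> h \<noteq> 0 \<Longrightarrow> C \<subseteq> {y. h \<bullet> y = 0} \<Longrightarrow> \<theta> C = 0"
    and frame_mem: "frame_det v \<noteq> 0 \<Longrightarrow> frame_cone v \<in> D"
    and frame_null: "frame_det v \<noteq> 0 \<Longrightarrow> \<theta> (frame_cone v) = 0"
begin

text \<open>Half-spaces are intersected one at a time.  If the bounding hyperplane separates two of the
  vectors, then the cone is cut at the ray where the hyperplane meets the cone of these two; both
  parts have fewer vectors off the hyperplane.  Otherwise the half-space contains the cone, or the
  intersection lies in the hyperplane.\<close>

lemma theta_frame_Int_halfspaces:
  assumes "finite N" "frame_det v \<noteq> 0"
  shows "\<theta> (frame_cone v \<inter> {y. \<forall>h\<in>N. 0 \<le> h \<bullet> y}) = 0"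
  using assms
proof (induction N arbitrary: v rule: finite_induct)
  case empty
  then show ?case by (simp add: frame_null)
next
  case (insert h N)
  let ?Q = "\<lambda>N. {y. \<forall>h\<in>N. 0 \<le> h \<bullet> y}"
  have Q: "?Q M \<in> polyhedral_cones" if "finite M" for M :: "(real^'d) set"
    using that unfolding polyhedral_cone_iff by blast
  have QD: "frame_cone w \<inter> ?Q M \<in> D" if "frame_det w \<noteq> 0" "finite M" for w M
    using frame_mem[OF that(1)] polyhedral_cone_Int[OF frame_cone_polyhedral[OF that(1)] Q[OF that(2)]]
    by (rule subcone) auto
  show ?case using insert.prems
  proof (induction "card {i. h \<bullet> v i \<noteq> 0}" arbitrary: v rule: less_induct)
    case less
    consider "\<forall>i. 0 \<le> h \<bullet> v i" | "\<forall>i. h \<bullet> v i \<le> 0" "h \<noteq> 0"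
      | i j where "0 < h \<bullet> v i" "h \<bullet> v j < 0"
      by (metis inner_zero_left linorder_not_le order_refl)
    then show ?case
    proof cases
      case 1
      have "0 \<le> h \<bullet> y" if "y \<in> frame_cone v" for y
        using that 1 unfolding frame_cone_def by (auto simp: inner_sum_right intro!: sum_nonneg)
      then have "frame_cone v \<inter> ?Q (insert h N) = frame_cone v \<inter> ?Q N" by auto
      then show ?thesis using insert.IH[OF less.prems] by simp
    next
      case 2
      have "h \<bullet> y \<le> 0" if "y \<in> frame_cone v" for y
        using that 2(1) unfolding frame_cone_def
        by (auto simp: inner_sum_right mult_nonneg_nonpos intro!: sum_nonpos)
      then have "frame_cone v \<inter> ?Q (insert h N) \<subseteq> {y. h \<bullet> y = 0}" by force
      then show ?thesis
        using QD[OF less.prems, of "insert h N"] insert.hyps(1) 2(2) by (intro null) auto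
    next
      case 3
      define a b where "a = - (h \<bullet> v j)" and "b = h \<bullet> v i"
      have ab: "0 < a" "0 < b" and ij: "i \<noteq> j" using 3 by (auto simp: a_def b_def)
      define x where "x = a *\<^sub>R v i + b *\<^sub>R v j"
      have hx: "h \<bullet> x = 0" by (simp add: x_def a_def b_def inner_right_distrib inner_diff_right)
      have di: "frame_det (v(i := x)) \<noteq> 0"
        using less.prems ab frame_det_upd_two[OF ij, of v a b] by (simp add: x_def)
      have dj: "frame_det (v(j := x)) \<noteq> 0"
        using less.prems ab frame_det_upd_two[OF not_sym[OF ij], of v b a] by (simp add: x_def add.commute)
      note split = frame_cone_split[OF less.prems ij ab x_def]
      obtain g where g: "g \<noteq> 0" "frame_cone (v(i := x)) \<inter> frame_cone (v(j := x)) \<subseteq> {y. g \<bullet> y = 0}"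
        using split(2) by blast
      let ?H = "?Q (insert h N)"
      have fin: "finite (insert h N)" using insert.hyps(1) by simp
      have "\<theta> (frame_cone (v(i := x)) \<inter> ?H) = 0"
      proof (rule less.hyps[OF _ di])
        have "{k. h \<bullet> (v(i := x)) k \<noteq> 0} = {k. h \<bullet> v k \<noteq> 0} - {i}"
          using hx by auto
        moreover have "i \<in> {k. h \<bullet> v k \<noteq> 0}" using 3 by simp
        ultimately show "card {k. h \<bullet> (v(i := x)) k \<noteq> 0} < card {k. h \<bullet> v k \<noteq> 0}"
          by (simp only: card_Diff1_less finite_class.finite_code finite)
      qed
      moreover have "\<theta> (frame_cone (v(j := x)) \<inter> ?H) = 0"
      proof (rule less.hyps[OF _ dj])
        have "{k. h \<bullet> (v(j := x)) k \<noteq> 0} = {k. h \<bullet> v k \<noteq> 0} - {j}"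
          using hx by auto
        moreover have "j \<in> {k. h \<bullet> v k \<noteq> 0}" using 3 by simp
        ultimately show "card {k. h \<bullet> (v(j := x)) k \<noteq> 0} < card {k. h \<bullet> v k \<noteq> 0}"
          by (simp only: card_Diff1_less finite_class.finite_code finite)
      qed
      moreover have eq: "frame_cone v \<inter> ?H = (frame_cone (v(i := x)) \<inter> ?H) \<union> (frame_cone (v(j := x)) \<inter> ?H)"
        using split(1) by blast
      moreover have "\<theta> ((frame_cone (v(i := x)) \<inter> ?H) \<union> (frame_cone (v(j := x)) \<inter> ?H))
          = \<theta> (frame_cone (v(i := x)) \<inter> ?H) + \<theta> (frame_cone (v(j := x)) \<inter> ?H)"
      proof (rule cut[OF QD[OF di fin] QD[OF dj fin] _ g(1)])
        show "(frame_cone (v(i := x)) \<inter> ?H) \<union> (frame_cone (v(j := x)) \<inter> ?H) \<in> D"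
          using QD[OF less.prems fin] unfolding eq .
        show "(frame_cone (v(i := x)) \<inter> ?H) \<inter> (frame_cone (v(j := x)) \<inter> ?H) \<subseteq> {y. g \<bullet> y = 0}"
          using g(2) by blast
      qed
      ultimately show ?thesis by simp
    qed
  qed
qed

lemma theta_cut_by_orthants:
  assumes "finite K" "P \<in> D"
    and "\<And>s. (\<And>k. s k = 1 \<or> s k = - 1) \<Longrightarrow> \<theta> (P \<inter> {y. \<forall>k\<in>K. 0 \<le> s k * y $ k}) = 0"
  shows "\<theta> P = 0"
  using assms
proof (induction K arbitrary: P rule: finite_induct)
  case empty
  from empty(2)[of "\<lambda>_. 1"] show ?case by simp
next
  case (insert k K)
  have half: "P \<inter> {y. 0 \<le> t * y $ k} \<in> D" for t :: real
  proof -
    have eq: "{y. 0 \<le> t * y $ k} = {y. 0 \<le> (t *\<^sub>R axis k 1) \<bullet> y}"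
      by (simp add: inner_axis')
    have "P \<inter> {y. 0 \<le> t * y $ k} \<in> polyhedral_cones"
      unfolding eq
      by (rule polyhedral_cone_Int[OF subsetD[OF polyhedral insert.prems(1)] polyhedral_cone_halfspace])
    from subcone[OF insert.prems(1) this] show ?thesis by auto
  qed
  have zero: "\<theta> (P \<inter> {y. 0 \<le> t * y $ k}) = 0" if t: "t = 1 \<or> t = - 1" for t :: real
  proof (rule insert.IH[OF half])
    fix s :: "'d \<Rightarrow> real" assume s: "\<And>k. s k = 1 \<or> s k = - 1"
    have "P \<inter> {y. 0 \<le> t * y $ k} \<inter> {y. \<forall>k\<in>K. 0 \<le> s k * y $ k}
        = P \<inter> {y. \<forall>l\<in>insert k K. 0 \<le> (s(k := t)) l * y $ l}"
      using insert.hyps(2) by auto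
    then show "\<theta> (P \<inter> {y. 0 \<le> t * y $ k} \<inter> {y. \<forall>k\<in>K. 0 \<le> s k * y $ k}) = 0"
      using insert.prems(2)[of "s(k := t)"] s t by simp
  qed
  have eq: "P = (P \<inter> {y. 0 \<le> 1 * y $ k}) \<union> (P \<inter> {y. 0 \<le> - 1 * y $ k})" by auto
  have "\<theta> ((P \<inter> {y. 0 \<le> 1 * y $ k}) \<union> (P \<inter> {y. 0 \<le> - 1 * y $ k}))
      = \<theta> (P \<inter> {y. 0 \<le> 1 * y $ k}) + \<theta> (P \<inter> {y. 0 \<le> - 1 * y $ k})"
    using insert.prems(1) eq
    by (intro cut[OF half half, of _ _ "axis k 1"]) (auto simp: inner_axis' axis_eq_0_iff)
  then show ?case using zero[of 1] zero[of "- 1"] eq by simp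
qed

lemma theta_null:
  assumes P: "P \<in> D"
  shows "\<theta> P = 0"
proof (rule theta_cut_by_orthants[of UNIV, OF _ P])
  fix s :: "'d \<Rightarrow> real" assume s: "\<And>k. s k = 1 \<or> s k = - 1"
  obtain N where N: "finite N" "P = {y. \<forall>h\<in>N. 0 \<le> h \<bullet> y}"
    using subsetD[OF polyhedral P] unfolding polyhedral_cone_iff by blast
  have "P \<inter> {y. \<forall>k\<in>UNIV. 0 \<le> s k * y $ k} = frame_cone (\<lambda>k. s k *\<^sub>R axis k 1) \<inter> {y. \<forall>h\<in>N. 0 \<le> h \<bullet> y}"
    using N(2) orthant_frame(2)[of s, OF s] by auto
  then show "\<theta> (P \<inter> {y. \<forall>k\<in>UNIV. 0 \<le> s k * y $ k}) = 0"
    using theta_frame_Int_halfspaces[OF N(1) orthant_frame(1)[of s, OF s]] by simp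
qed simp

end

section \<open>Comparison with the volume and the simple extension\<close>

lemma cone_vol_cut:
  assumes "C1 \<in> polyhedral_cones" "C2 \<in> polyhedral_cones" "h \<noteq> 0" "C1 \<inter> C2 \<subseteq> {y. h \<bullet> y = 0}"
  shows "cone_vol (C1 \<union> C2) = cone_vol C1 + cone_vol C2"
proof -
  have "C1 \<in> sets borel" "C2 \<in> sets borel" "C1 \<inter> C2 \<in> sets borel"
    using assms by (auto intro: borel_closed polyhedral_cone_closed closed_Int)
  then show ?thesis
    using cone_vol_Un[of C1 C2] cone_vol_in_hyperplane[OF assms(3,4)] by simp
qed

context integrable_cone_valuation
begin

text \<open>The value at the zero cone is reset to zero for the comparison, as \<open>\<eta>\<close> is a valuation only on
  nonzero cones and may take any value there.\<close>

lemma eta_eq_cone_vol: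
  assumes P: "P \<in> nonzero_pointed_polyhedral_cones"
  shows "\<eta> P = fan_total (\<lambda>i. axis i 1) * cone_vol P"
proof -
  let ?k = "fan_total (\<lambda>i. axis i 1)"
  define D where "D = {C :: (real^'d) set. C \<in> polyhedral_cones \<and> pointed_cone C}"
  define \<theta> where "\<theta> C = (if C = {0} then 0 else \<eta> C) - ?k * cone_vol C" for C
  have nz: "C \<in> nonzero_pointed_polyhedral_cones" if "C \<in> D" "C \<noteq> {0}" for C
    using that by (simp add: D_def nonzero_pointed_polyhedral_cones_def)
  have borel: "C \<in> sets borel" if "C \<in> D" for C
    using that by (auto simp: D_def intro: borel_closed polyhedral_cone_closed)
  interpret frame_null_functional D \<theta>
  proof
    show "D \<subseteq> polyhedral_cones" by (auto simp: D_def)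
    show "C' \<in> D" if "C \<in> D" "C' \<in> polyhedral_cones" "C' \<subseteq> C" for C C'
      using that pointed_cone_subset polyhedral_cone_0 by (auto simp: D_def)
    show "\<theta> (C1 \<union> C2) = \<theta> C1 + \<theta> C2"
      if C: "C1 \<in> D" "C2 \<in> D" "C1 \<union> C2 \<in> D" and h: "h \<noteq> 0" "C1 \<inter> C2 \<subseteq> {y. h \<bullet> y = 0}" for C1 C2 h
    proof -
      have vol: "cone_vol (C1 \<union> C2) = cone_vol C1 + cone_vol C2"
        using C h by (intro cone_vol_cut) (auto simp: D_def)
      have 0: "0 \<in> C1" "0 \<in> C2" using C polyhedral_cone_0 by (auto simp: D_def)
      consider "C1 = {0}" | "C2 = {0}" | "C1 \<noteq> {0}" "C2 \<noteq> {0}" by blast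
      then show ?thesis
      proof cases
        case 1
        then have "C1 \<union> C2 = C2" using 0 by auto
        then show ?thesis using vol 1 by (simp add: \<theta>_def algebra_simps)
      next
        case 2
        then have "C1 \<union> C2 = C1" using 0 by auto
        then show ?thesis using vol 2 by (simp add: \<theta>_def algebra_simps)
      next
        case 3
        then have "C1 \<union> C2 \<noteq> {0}" using 0 by blast
        then show ?thesis
          using eta_cut[OF nz[OF C(1)] nz[OF C(2)] nz[OF C(3)] h] 3 vol by (simp add: \<theta>_def algebra_simps)
      qed
    qed
    show "\<theta> C = 0" if "C \<in> D" "h \<noteq> 0" "C \<subseteq> {y. h \<bullet> y = 0}" for C h
      using that eta_in_hyperplane[OF nz] cone_vol_in_hyperplane[of h C] borel[OF that(1)]
      by (auto simp: \<theta>_def)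
    show "frame_cone v \<in> D" if "frame_det v \<noteq> 0" for v
      using frame_cone_mem[OF that] by (simp add: D_def nonzero_pointed_polyhedral_cones_def)
    show "\<theta> (frame_cone v) = 0" if "frame_det v \<noteq> 0" for v
      using frame_cone_mem[OF that] eta_frame_cone[OF that]
      by (simp add: \<theta>_def nonzero_pointed_polyhedral_cones_def)
  qed
  from P have "\<theta> P = 0"
    by (intro theta_null) (simp add: D_def nonzero_pointed_polyhedral_cones_def)
  then show ?thesis using P by (simp add: \<theta>_def nonzero_pointed_polyhedral_cones_def)
qed

lemma is_simple_extension_cone_vol:
  "is_simple_extension \<eta> (\<lambda>P. fan_total (\<lambda>i. axis i 1) * cone_vol P)"
proof -
  have borel: "C \<in> sets borel" if "C \<in> polyhedral_cones" for C :: "(real^'d) set"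
    using that by (intro borel_closed polyhedral_cone_closed)
  have low: "cone_vol C = 0" if C: "C \<in> polyhedral_cones" "dim C \<le> CARD('d) - 1" for C :: "(real^'d) set"
  proof -
    have "dim C < DIM(real^'d)" using C(2) card_ge_2 by simp
    then obtain h where h: "h \<noteq> 0" "span C \<subseteq> {x. h \<bullet> x = 0}"
      using lowdim_subset_hyperplane by blast
    then have "C \<subseteq> {x. h \<bullet> x = 0}" using span_superset by blast
    then show ?thesis using h(1) borel[OF C(1)] by (intro cone_vol_in_hyperplane)
  qed
  show ?thesis
    unfolding is_simple_extension_def valuation_on_def simple_on_def
    using low borel eta_eq_cone_vol by (auto simp: cone_vol_Un algebra_simps)
qed

text \<open>An extension agrees with \<open>\<eta>\<close>, and so with the multiple of the volume, on simplicial cones; cutting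
  carries this to the whole space.\<close>

lemma simple_extension_unique_UNIV:
  assumes ext: "is_simple_extension \<eta> \<eta>'"
  shows "\<eta>' UNIV = fan_total (\<lambda>i. axis i 1)"
proof -
  let ?k = "fan_total (\<lambda>i. axis i 1)"
  have val: "valuation_on polyhedral_cones \<eta>'" and simp': "simple_on polyhedral_cones \<eta>'"
    and eq: "\<And>C. C \<in> nonzero_pointed_polyhedral_cones \<Longrightarrow> \<eta>' C = \<eta> C"
    using ext by (auto simp: is_simple_extension_def)
  have low: "\<eta>' C = 0" if "C \<in> polyhedral_cones" "h \<noteq> 0" "C \<subseteq> {y. h \<bullet> y = 0}" for C h
  proof -
    have "dim C \<le> CARD('d) - 1"
      using dim_subset[OF that(3)] dim_hyperplane[OF that(2)] by simp
    then show ?thesis using simp' that(1) by (simp add: simple_on_def)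
  qed
  interpret frame_null_functional polyhedral_cones "\<lambda>C. \<eta>' C - ?k * cone_vol C"
  proof
    show "\<eta>' (C1 \<union> C2) - ?k * cone_vol (C1 \<union> C2) =
        \<eta>' C1 - ?k * cone_vol C1 + (\<eta>' C2 - ?k * cone_vol C2)"
      if C: "C1 \<in> polyhedral_cones" "C2 \<in> polyhedral_cones" "C1 \<union> C2 \<in> polyhedral_cones"
        and h: "h \<noteq> 0" "C1 \<inter> C2 \<subseteq> {y. h \<bullet> y = 0}" for C1 C2 h
    proof -
      have "\<eta>' (C1 \<union> C2) = \<eta>' C1 + \<eta>' C2 - \<eta>' (C1 \<inter> C2)"
        using val C unfolding valuation_on_def by blast
      then show ?thesis
        using low[OF polyhedral_cone_Int[OF C(1,2)] h] cone_vol_cut[OF C(1,2) h]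
        by (simp add: algebra_simps)
    qed
    show "\<eta>' C - ?k * cone_vol C = 0"
      if "C \<in> polyhedral_cones" "h \<noteq> 0" "C \<subseteq> {y. h \<bullet> y = 0}" for C h
      using low[OF that] cone_vol_in_hyperplane[OF that(2,3)] borel_closed[OF polyhedral_cone_closed[OF that(1)]]
      by simp
    show "\<eta>' (frame_cone v) - ?k * cone_vol (frame_cone v) = 0" if "frame_det v \<noteq> 0" for v
      using that by (simp add: eq eta_frame_cone frame_cone_mem)
  qed (simp_all add: frame_cone_polyhedral)
  have "UNIV \<in> (polyhedral_cones :: (real^'d) set set)"
    unfolding polyhedral_cone_iff by (intro exI[of _ "{}"]) auto
  from theta_null[OF this] show ?thesis by (simp add: cone_vol_UNIV)
qed

end

theorem theorem3p8:
  fixes \<eta> :: "(real^'d) set \<Rightarrow> real"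
  assumes "CARD('d) \<ge> 2"
    and "valuation_on nonzero_pointed_polyhedral_cones \<eta>"
    and "simple_on nonzero_pointed_polyhedral_cones \<eta>"
    and "SO_invariant_on nonzero_pointed_polyhedral_cones \<eta>"
    and "\<And>F. pointed_simplicial_cone F \<Longrightarrow> dim F = CARD('d) - 1 \<Longrightarrow>
           set_integrable sphere_prob (sphere 0 1 - span F) (\<lambda>x. \<eta> (add_ray F x))"
  shows "\<forall>P\<in>nonzero_pointed_polyhedral_cones.
           \<eta> P = simple_extension \<eta> UNIV * cone_vol P"
proof -
  interpret integrable_cone_valuation \<eta>
    using assms by unfold_locales
  have "simple_extension \<eta> UNIV = fan_total (\<lambda>i. axis i 1)"
    unfolding simple_extension_def
  proof (rule the_equality)
    show "\<exists>\<eta>'. is_simple_extension \<eta> \<eta>' \<and> \<eta>' UNIV = fan_total (\<lambda>i. axis i 1)"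
      by (intro exI conjI, rule is_simple_extension_cone_vol) (simp add: cone_vol_UNIV)
  qed (blast dest: simple_extension_unique_UNIV)
  then show ?thesis using eta_eq_cone_vol by simp
qed

end
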